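(* Let $d\ge3$ and let $p,q\ge1$ be such that $$\frac1p+\frac1q>\frac2{d-1}.$$ Then there is a law $\mathbb P$ on nearest-neighbor conductances $\{C_{x,y}=C_{y,x}\colon x,y\in\mathbb Z^d\}$ on $\mathbb Z^d$ that is stationary and jointly ergodic with respect to the shifts of $\mathbb Z^d$ and satisfies $$|x|=1\quad\Rightarrow\quad C_{0,x}\in L^p(\mathbb P)\quad\text{and}\quad\frac1{C_{0,x}}\in L^q(\mathbb P),$$ for which the associated corrector $\chi$ is well defined, but not sublinear everywhere; that is, the statement $$\lim_{n\to\infty}\frac1n\max_{x\colon|x|\le n}|\chi(x)|=0\qquad\mathbb P\text{-a.s.}$$ fails.
   Context: $|\cdot|$ is the Euclidean norm. Conductances are non-negative; "nearest-neighbor" means $C_{x,y}=0$ unless $|x-y|=1$ (in particular $C_{x,x}=0$). Joint ergodicity means events invariant under all shifts have probability $0$ or $1$. $\mathbb E$ is expectation under $\mathbb P$. With $\pi(x):=\sum_yC_{x,y}$, set $$(\mathsf Lf)(x):=\frac1{\pi(x)}\sum_{y\in\mathbb Z^d}C_{x,y}[f(y)-f(x)].$$ Corrector. Realize the conductances on the canonical space $\Omega$ of configurations $\omega=\{C_{x,y}\}$, with shifts $(\tau_z\omega)_{x,y}:=C_{x+z,y+z}$. The corrector is well defined when $\mathbb E\bigl(\sum_xC_{0,x}|x|^2\bigr)<\infty$ and $\mathbb E(1/C_{0,x})<\infty$ for $|x|=1$; it is then the ($\mathbb P$-a.s. unique) measurable $\chi\colon\Omega\times\mathbb Z^d\to\mathbb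 R^d$, written $\chi(x)=\chi(\omega,x)$, such that: (1) $\chi(0)=0$; (2) increments are stationary (shift-covariant): $\chi(\omega,x)-\chi(\omega,y)=\chi(\tau_y\omega,x-y)$ for all $x,y$, $\mathbb P$-a.s.; (3) $\mathbb E\bigl(\sum_xC_{0,x}|\chi(x)|^2\bigr)<\infty$; (4) $\Psi(x):=x+\chi(x)$ satisfies $(\mathsf L\Psi)(x)=0$ for all $x\in\mathbb Z^d$, $\mathbb P$-a.s.; (5) $\chi$ belongs to the closure, in the seminorm $u\mapsto\bigl(\mathbb E\sum_xC_{0,x}|u(\omega,x)|^2\bigr)^{1/2}$, of the set of gradients $u(\omega,x)=h(\tau_x\omega)-h(\omega)$ with $h\colon\Omega\to\mathbb R^d$ bounded and measurable. *)

theory Defs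
  imports "HOL-Probability.Probability"
begin

text \<open>The dimension \<open>d\<close> is \<open>CARD('d)\<close>. A configuration maps the pair \<open>(x, y)\<close> to \<open>C\<^sub>x\<^sub>,\<^sub>y\<close>.\<close>

type_synonym 'd site = "int ^ 'd"

type_synonym 'd conf = "'d site \<times> 'd site \<Rightarrow> real"

definition rvec :: "'d::finite site \<Rightarrow> real ^ 'd" where
  "rvec x = (\<chi> i. real_of_int (x $ i))"

definition nn_confs :: "'d::finite conf set" where
  "nn_confs = {\<omega>. (\<forall>x y. 0 \<le> \<omega> (x, y)) \<and> (\<forall>x y. \<omega> (x, y) = \<omega> (y, x)) \<and>
     (\<forall>x y. norm (rvec (x - y)) \<noteq> 1 \<longrightarrow> \<omega> (x, y) = 0)}"

definition conf_space :: "'d::finite conf measure" where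
  "conf_space = restrict_space (PiM UNIV (\<lambda>_. borel)) nn_confs"

definition conductance_law :: "'d::finite conf measure \<Rightarrow> bool" where
  "conductance_law P \<longleftrightarrow> prob_space P \<and> sets P = sets conf_space"

definition translate :: "'d::finite site \<Rightarrow> 'd conf \<Rightarrow> 'd conf" where
  "translate z \<omega> = (\<lambda>(x, y). \<omega> (x + z, y + z))"

definition stationary :: "'d::finite conf measure \<Rightarrow> bool" where
  "stationary P \<longleftrightarrow> (\<forall>z. distr P P (translate z) = P)"

definition jointly_ergodic :: "'d::finite conf measure \<Rightarrow> bool" where
  "jointly_ergodic P \<longleftrightarrow>
     (\<forall>A\<in>sets P. (\<forall>z. translate z -` A \<inter> space P = A) \<longrightarrow> measure P A = 0 \<or> measure P A = 1)"

definition in_Lp :: "'a measure \<Rightarrow> real \<Rightarrow> ('a \<Rightarrow> real) \<Rightarrow> bool" where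
  "in_Lp M p f \<longleftrightarrow> f \<in> borel_measurable M \<and> integrable M (\<lambda>\<omega>. \<bar>f \<omega>\<bar> powr p)"

definition total_conductance :: "'d::finite conf \<Rightarrow> 'd site \<Rightarrow> real" where
  "total_conductance \<omega> x = (\<Sum>\<^sub>\<infinity>y. \<omega> (x, y))"

definition generator :: "'d::finite conf \<Rightarrow> ('d site \<Rightarrow> real ^ 'd) \<Rightarrow> 'd site \<Rightarrow> real ^ 'd" where
  "generator \<omega> f x = (\<Sum>\<^sub>\<infinity>y. \<omega> (x, y) *\<^sub>R (f y - f x)) /\<^sub>R total_conductance \<omega> x"

text \<open>The square of the seminorm, with values in \<open>[0, \<infinity>]\<close>.\<close>

definition energy :: "'d::finite conf measure \<Rightarrow> ('d conf \<Rightarrow> 'd site \<Rightarrow> real ^ 'd) \<Rightarrow> ennreal" where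
  "energy P u = (\<integral>\<^sup>+ \<omega>. (\<Sum>\<^sub>\<infinity>x. ennreal (\<omega> (0, x) * (norm (u \<omega> x))\<^sup>2)) \<partial>P)"

definition grad :: "('d::finite conf \<Rightarrow> real ^ 'd) \<Rightarrow> 'd conf \<Rightarrow> 'd site \<Rightarrow> real ^ 'd" where
  "grad h \<omega> x = h (translate x \<omega>) - h \<omega>"

definition in_gradient_closure ::
    "'d::finite conf measure \<Rightarrow> ('d conf \<Rightarrow> 'd site \<Rightarrow> real ^ 'd) \<Rightarrow> bool" where
  "in_gradient_closure P u \<longleftrightarrow>
     (\<forall>\<epsilon>>0. \<exists>h. h \<in> borel_measurable P \<and> (\<exists>B. \<forall>\<omega>\<in>space P. norm (h \<omega>) \<le> B) \<and>
        energy P (\<lambda>\<omega> x. u \<omega> x - grad h \<omega> x) < ennreal (\<epsilon>\<^sup>2))"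

definition is_corrector ::
    "'d::finite conf measure \<Rightarrow> ('d conf \<Rightarrow> 'd site \<Rightarrow> real ^ 'd) \<Rightarrow> bool" where
  "is_corrector P X \<longleftrightarrow>
     (\<lambda>(\<omega>, x). X \<omega> x) \<in> borel_measurable (P \<Otimes>\<^sub>M count_space UNIV) \<and>
     (\<forall>\<omega>\<in>space P. X \<omega> 0 = 0) \<and>
     (AE \<omega> in P. \<forall>x y. X \<omega> x - X \<omega> y = X (translate y \<omega>) (x - y)) \<and>
     energy P X < \<infinity> \<and>
     (AE \<omega> in P. \<forall>x. generator \<omega> (\<lambda>z. rvec z + X \<omega> z) x = 0) \<and>
     in_gradient_closure P X"

text \<open>The moment conditions, and existence and almost sure uniqueness of the corrector. The
  quotient \<open>1 / ennreal c\<close> is \<open>\<infinity>\<close> at \<open>c = 0\<close>.\<close>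

definition corrector_well_defined :: "'d::finite conf measure \<Rightarrow> bool" where
  "corrector_well_defined P \<longleftrightarrow>
     energy P (\<lambda>\<omega>. rvec) < \<infinity> \<and>
     (\<forall>x. norm (rvec x) = 1 \<longrightarrow> (\<integral>\<^sup>+ \<omega>. 1 / ennreal (\<omega> (0, x)) \<partial>P) < \<infinity>) \<and>
     (\<exists>X. is_corrector P X \<and>
        (\<forall>Y. is_corrector P Y \<longrightarrow> (AE \<omega> in P. \<forall>x. Y \<omega> x = X \<omega> x)))"

definition sublinear_everywhere ::
    "'d::finite conf measure \<Rightarrow> ('d conf \<Rightarrow> 'd site \<Rightarrow> real ^ 'd) \<Rightarrow> bool" where
  "sublinear_everywhere P X \<longleftrightarrow>
     (AE \<omega> in P. (\<lambda>n::nat. 1 / real n * Max ((\<lambda>x. norm (X \<omega> x)) ` {x. norm (rvec x) \<le> real n}))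
        \<longlonglongrightarrow> 0)"

text \<open>Since \<open>1 / 0 = 0\<close> for reals, \<open>1 / C\<^sub>0\<^sub>,\<^sub>x \<in> L\<^sup>q\<close> includes the condition \<open>C\<^sub>0\<^sub>,\<^sub>x > 0\<close>
  almost surely.\<close>

definition moment_conditions :: "'d::finite conf measure \<Rightarrow> real \<Rightarrow> real \<Rightarrow> bool" where
  "moment_conditions P p q \<longleftrightarrow>
     (\<forall>x. norm (rvec x) = 1 \<longrightarrow>
        in_Lp P p (\<lambda>\<omega>. \<omega> (0, x)) \<and>
        (AE \<omega> in P. 0 < \<omega> (0, x)) \<and> in_Lp P q (\<lambda>\<omega>. 1 / \<omega> (0, x)))"

end

theory Submission
  imports Defs
begin

text \<open>
The environment consists of strongly conducting line segments that are almost insulated from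
  the rest of the lattice. At every scale \<open>N = 2 ^ k\<close> there is an \<open>N\<close>-periodic family of segments of
  \<open>N\<close> sites in one coordinate direction. The edges inside a segment of this scale have conductance
  \<open>A ^ k\<close>, all other edges at its sites have conductance \<open>1 / B ^ k\<close>, and edges away from all segments
  have conductance \<open>1\<close>. A site lies on a segment of this scale with probability of order
  \<open>N powr - (d - 1)\<close>, so \<open>C \<in> L\<^sup>p\<close> and \<open>1 / C \<in> L\<^sup>q\<close> as soon as \<open>A powr p\<close> and \<open>B powr q\<close> are below
  \<open>2 ^ (d - 1)\<close>. The condition on the exponents says precisely that such \<open>A\<close> and \<open>B\<close> exist with
  \<open>A * B > 4\<close> (\<open>exponents_exist\<close>).

  Suppose that the corrector \<open>\<chi>\<close> were sublinear. Then \<open>\<Psi> x = x + \<chi> x\<close> is of order \<open>N\<close> in a box of size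
  of order \<open>N\<close>, and by periodicity such a box around the origin always contains a segment of scale
  \<open>N\<close>. Since \<open>\<Psi>\<close> is harmonic, currents are conserved at the sites of the segment. Each site receives
  from outside the segment at most a current of order \<open>N / B ^ k\<close>, so the current along the segment is
  at most of order \<open>N\<^sup>2 / B ^ k\<close>, and the difference of \<open>\<Psi>\<close> between its two ends is at most of order
  \<open>N\<^sup>3 / (A * B) ^ k = N * (4 / (A * B)) ^ k\<close>, which is small compared with \<open>N\<close>. So \<open>\<Psi>\<close> is nearly
  constant on the segment, although \<open>x\<close> moves by \<open>N - 1\<close>. Hence \<open>\<chi>\<close> varies by almost \<open>N\<close> there, which
  contradicts sublinearity. This is \<open>no_sublinear_harmonic\<close>.

  The pattern is a fixed function of a random element of the \<open>d\<close>-fold product of the 2-adic integers,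
  given by its residues modulo \<open>2 ^ k\<close>, and shifts of the lattice act by adding integers. They act
  transitively on the residues modulo each \<open>2 ^ k\<close>. So an invariant event has the same conditional
  probability given each residue, is independent of all residues, hence of itself, and has
  probability \<open>0\<close> or \<open>1\<close> (\<open>odometer_ergodic\<close>). Segments of different scales do not meet, because a
  second coordinate has 2-adic valuation \<open>k - 1\<close> on all segments of scale \<open>k\<close>; the valuation is at
  least \<open>1\<close>, so segments of different scales are not even joined by an edge.

  For every stationary law whose conductances are almost surely positive and integrable, the
  corrector exists and is unique. It is minus the orthogonal projection of the identity onto the
  closure of the gradients in \<open>L\<^sup>2\<close> (\<open>L2_projection\<close>); orthogonality to all gradients is harmonicity,
  by integration by parts (\<open>integral_flux_grad\<close>).
\<close>

section \<open>Projection onto a subspace of square integrable functions\<close>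

definition square_integrable :: "'a measure \<Rightarrow> ('a \<Rightarrow> 'b::euclidean_space) \<Rightarrow> bool" where
  "square_integrable M f \<longleftrightarrow> f \<in> borel_measurable M \<and> integrable M (\<lambda>x. (norm (f x))\<^sup>2)"

lemma square_integrableD:
  assumes "square_integrable M f"
  shows "f \<in> borel_measurable M" "integrable M (\<lambda>x. (norm (f x))\<^sup>2)"
  using assms by (auto simp: square_integrable_def)

lemma norm_add_sq_le: "(norm (a + b :: 'b::euclidean_space))\<^sup>2 \<le> 2 * (norm a)\<^sup>2 + 2 * (norm b)\<^sup>2"
proof -
  have "(norm (a + b))\<^sup>2 \<le> (norm a + norm b)\<^sup>2"
    by (intro power_mono norm_triangle_ineq) auto
  also have "\<dots> \<le> 2 * (norm a)\<^sup>2 + 2 * (norm b)\<^sup>2"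
    using sum_squares_bound[of "norm a" "norm b"] by (simp add: power2_sum)
  finally show ?thesis .
qed

lemma abs_inner_le_AM_GM:
  fixes a b :: "'b::euclidean_space"
  assumes "0 < s"
  shows "\<bar>a \<bullet> b\<bar> \<le> (norm a)\<^sup>2 / (2 * s) + s / 2 * (norm b)\<^sup>2"
proof -
  have "\<bar>a \<bullet> b\<bar> \<le> norm a * norm b" by (rule Cauchy_Schwarz_ineq2)
  also have "\<dots> \<le> (norm a)\<^sup>2 / (2 * s) + s / 2 * (norm b)\<^sup>2"
  proof -
    have "0 \<le> (norm a - s * norm b)\<^sup>2" by simp
    then have "2 * s * (norm a * norm b) \<le> (norm a)\<^sup>2 + s\<^sup>2 * (norm b)\<^sup>2"
      by (simp add: power2_diff power_mult_distrib algebra_simps)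
    then show ?thesis using assms by (simp add: field_simps power2_eq_square)
  qed
  finally show ?thesis .
qed

lemma square_integrable_add:
  assumes "square_integrable M f" "square_integrable M g"
  shows "square_integrable M (\<lambda>x. f x + g x)"
  unfolding square_integrable_def
proof
  note [measurable] = assms[THEN square_integrableD(1)]
  show "(\<lambda>x. f x + g x) \<in> borel_measurable M" by measurable
  show "integrable M (\<lambda>x. (norm (f x + g x))\<^sup>2)"
    by (rule Bochner_Integration.integrable_bound
         [where f = "\<lambda>x. 2 * (norm (f x))\<^sup>2 + 2 * (norm (g x))\<^sup>2"])
       (use assms in \<open>auto simp: square_integrable_def norm_add_sq_le\<close>)
qed

lemma square_integrable_scaleR:
  "square_integrable M f \<Longrightarrow> square_integrable M (\<lambda>x. c *\<^sub>R f x)"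
  by (auto simp: square_integrable_def power_mult_distrib)

lemma square_integrable_diff:
  assumes "square_integrable M f" "square_integrable M g"
  shows "square_integrable M (\<lambda>x. f x - g x)"
  using square_integrable_add[OF assms(1) square_integrable_scaleR[OF assms(2), of "-1"]] by simp

lemma integrable_inner:
  assumes "square_integrable M f" "square_integrable M g"
  shows "integrable M (\<lambda>x. f x \<bullet> g x)"
proof -
  note [measurable] = assms[THEN square_integrableD(1)]
  show ?thesis
    by (rule Bochner_Integration.integrable_bound
         [where f = "\<lambda>x. (norm (f x))\<^sup>2 / 2 + 1 / 2 * (norm (g x))\<^sup>2"])
       (use assms abs_inner_le_AM_GM[of 1] in \<open>auto simp: square_integrable_def\<close>)
qed

lemma integral_norm_add_sq:
  assumes "square_integrable M f" "square_integrable M g"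
  shows "(\<integral>x. (norm (f x + c *\<^sub>R g x))\<^sup>2 \<partial>M) =
    (\<integral>x. (norm (f x))\<^sup>2 \<partial>M) + 2 * c * (\<integral>x. f x \<bullet> g x \<partial>M) + c\<^sup>2 * (\<integral>x. (norm (g x))\<^sup>2 \<partial>M)"
proof -
  have "(norm (f x + c *\<^sub>R g x))\<^sup>2 = (norm (f x))\<^sup>2 + 2 * c * (f x \<bullet> g x) + c\<^sup>2 * (norm (g x))\<^sup>2" for x
    unfolding power2_norm_eq_inner
    by (simp add: inner_add_left inner_add_right inner_commute[of "g x" "f x"]
        power2_eq_square algebra_simps)
  moreover have "integrable M (\<lambda>x. (norm (f x))\<^sup>2)" "integrable M (\<lambda>x. (norm (g x))\<^sup>2)"
    "integrable M (\<lambda>x. f x \<bullet> g x)"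
    using assms integrable_inner by (auto simp: square_integrable_def)
  ultimately show ?thesis by simp
qed

text \<open>By \<open>b \<le> 2 ^ n * b\<^sup>2 + (1/2) ^ n\<close> the weights make the increments themselves summable. Since the
  hypothesis is a series of squares, it can be checked almost everywhere by integrating termwise,
  on a measure space that need not be finite.\<close>

lemma convergent_of_weighted_squares:
  fixes v :: "nat \<Rightarrow> 'b::euclidean_space"
  assumes "summable (\<lambda>n. 2 ^ n * (norm (v (Suc n) - v n))\<^sup>2)"
  shows "convergent v"
proof -
  define a where "a n = 2 ^ n * (norm (v (Suc n) - v n))\<^sup>2" for n
  have le: "norm (v (Suc n) - v n) \<le> a n + (1/2) ^ n" for n
  proof -
    let ?b = "norm (v (Suc n) - v n)"
    show ?thesis
    proof (cases "?b \<le> (1/2) ^ n")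
      case True
      have "0 \<le> a n" by (simp add: a_def)
      with True show ?thesis by linarith
    next
      case False
      then have "1 \<le> 2 ^ n * ?b" by (simp add: field_simps power_divide)
      then have "1 * ?b \<le> (2 ^ n * ?b) * ?b" by (intro mult_right_mono) auto
      also have "\<dots> = a n" by (simp add: a_def power2_eq_square)
      also have "\<dots> \<le> a n + (1/2) ^ n" by simp
      finally show ?thesis by simp
    qed
  qed
  have "summable (\<lambda>n. a n + (1/2) ^ n)"
    using assms by (intro summable_add) (auto simp: a_def intro!: summable_geometric)
  then have "summable (\<lambda>n. v (Suc n) - v n)"
    by (rule summable_comparison_test') (use le in auto)
  then obtain l where "(\<lambda>n. \<Sum>i<n. v (Suc i) - v i) \<longlonglongrightarrow> l"
    by (auto simp: summable_def sums_def)
  then have "(\<lambda>n. v n - v 0) \<longlonglongrightarrow> l" by (simp add: sum_lessThan_telescope)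
  then have "(\<lambda>n. (v n - v 0) + v 0) \<longlonglongrightarrow> l + v 0" by (intro tendsto_intros)
  then show ?thesis by (auto simp: convergent_def)
qed

text \<open>Completeness of \<open>L\<^sup>2\<close> in the form in which it is used: the limit is also an almost sure limit
  of the whole sequence, which later turns a limit of gradients into a function that is still
  shift-covariant. The bound on the distance to the limit is Fatou's lemma.\<close>

lemma rapidly_Cauchy_L2_limit:
  fixes v :: "nat \<Rightarrow> 'a \<Rightarrow> 'b::euclidean_space"
  assumes v: "\<And>n. square_integrable M (v n)"
    and le: "\<And>n m. n \<le> m \<Longrightarrow> (\<integral>x. (norm (v m x - v n x))\<^sup>2 \<partial>M) \<le> 4 * (1/4) ^ n"
  obtains w where "square_integrable M w" "AE x in M. (\<lambda>n. v n x) \<longlonglongrightarrow> w x"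
    "\<And>n. (\<integral>x. (norm (w x - v n x))\<^sup>2 \<partial>M) \<le> 4 * (1/4) ^ n"
proof -
  have [measurable]: "v n \<in> borel_measurable M" for n using v by (auto simp: square_integrable_def)
  have nn: "(\<integral>\<^sup>+x. ennreal ((norm (v m x - v n x))\<^sup>2) \<partial>M) \<le> ennreal (4 * (1/4) ^ n)" if "n \<le> m" for n m
    using le[OF that] square_integrable_diff[OF v v, of m n]
    by (subst nn_integral_eq_integral) (auto simp: square_integrable_def ennreal_leI)
  \<comment> \<open>The sum of \<open>2 ^ n\<close> times the squared distance of consecutive terms has a finite
    integral.\<close>
  have AEc: "AE x in M. convergent (\<lambda>n. v n x)"
  proof -
    have "(\<integral>\<^sup>+x. (\<Sum>n. ennreal (2 ^ n * (norm (v (Suc n) x - v n x))\<^sup>2)) \<partial>M) =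
      (\<Sum>n. \<integral>\<^sup>+x. ennreal (2 ^ n * (norm (v (Suc n) x - v n x))\<^sup>2) \<partial>M)"
      by (intro nn_integral_suminf) measurable
    also have "\<dots> = (\<Sum>n. ennreal (2 ^ n) * (\<integral>\<^sup>+x. ennreal ((norm (v (Suc n) x - v n x))\<^sup>2) \<partial>M))"
      by (intro suminf_cong) (simp add: ennreal_mult nn_integral_cmult)
    also have "\<dots> \<le> (\<Sum>n. ennreal (2 ^ n) * ennreal (4 * (1/4) ^ n))"
      by (intro suminf_le mult_left_mono nn) auto
    also have "\<dots> = (\<Sum>n. ennreal (4 * (1/2) ^ n))"
      by (intro suminf_cong) (simp add: ennreal_mult[symmetric] power_mult_distrib[symmetric])
    also have "\<dots> = ennreal (\<Sum>n. 4 * (1/2) ^ n)"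
      by (intro suminf_ennreal2) (auto intro!: summable_mult summable_geometric)
    also have "\<dots> < \<infinity>" by simp
    finally have "AE x in M. (\<Sum>n. ennreal (2 ^ n * (norm (v (Suc n) x - v n x))\<^sup>2)) \<noteq> \<infinity>"
      by (intro nn_integral_noteq_infinite) auto
    then show ?thesis
    proof eventually_elim
      case (elim x)
      then have "summable (\<lambda>n. 2 ^ n * (norm (v (Suc n) x - v n x))\<^sup>2)"
        by (intro summable_suminf_not_top) auto
      then show ?case by (rule convergent_of_weighted_squares)
    qed
  qed
  define w where "w x = lim (\<lambda>n. v n x)" for x
  have [measurable]: "w \<in> borel_measurable M" unfolding w_def by measurable
  have lim: "AE x in M. (\<lambda>n. v n x) \<longlonglongrightarrow> w x"
    using AEc by eventually_elim (simp add: w_def convergent_LIMSEQ_iff)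
  have fat: "(\<integral>\<^sup>+x. ennreal ((norm (w x - v n x))\<^sup>2) \<partial>M) \<le> ennreal (4 * (1/4) ^ n)" for n
  proof -
    have "(\<integral>\<^sup>+x. ennreal ((norm (w x - v n x))\<^sup>2) \<partial>M) =
      (\<integral>\<^sup>+x. liminf (\<lambda>m. ennreal ((norm (v m x - v n x))\<^sup>2)) \<partial>M)"
    proof (rule nn_integral_cong_AE, use lim in eventually_elim)
      case (elim x)
      then have "(\<lambda>m. ennreal ((norm (v m x - v n x))\<^sup>2)) \<longlonglongrightarrow> ennreal ((norm (w x - v n x))\<^sup>2)"
        by (intro tendsto_intros)
      then show ?case by (intro lim_imp_Liminf[symmetric]) auto
    qed
    also have "\<dots> \<le> liminf (\<lambda>m. \<integral>\<^sup>+x. ennreal ((norm (v m x - v n x))\<^sup>2) \<partial>M)"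
      by (rule nn_integral_liminf) measurable
    also have "\<dots> \<le> liminf (\<lambda>m. ennreal (4 * (1/4) ^ n))"
      by (intro Liminf_mono eventually_sequentiallyI[of n] nn) auto
    also have "\<dots> = ennreal (4 * (1/4) ^ n)" by (simp add: Liminf_const)
    finally show ?thesis .
  qed
  have sqd: "square_integrable M (\<lambda>x. w x - v n x)" for n
    unfolding square_integrable_def
    using le_less_trans[OF fat ennreal_less_top] by (auto intro!: integrableI_bounded)
  have "square_integrable M (\<lambda>x. (w x - v 0 x) + v 0 x)"
    by (intro square_integrable_add sqd v)
  then have sqw: "square_integrable M w" by simp
  have "(\<integral>x. (norm (w x - v n x))\<^sup>2 \<partial>M) \<le> 4 * (1/4) ^ n" for n
    using fat[of n] sqd[of n]
    by (subst (asm) nn_integral_eq_integral) (auto simp: square_integrable_def)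
  with sqw lim show ?thesis by (rule that)
qed

lemma quarter_power: "(1/4 :: real) ^ n = ((1/2) ^ n)\<^sup>2"
proof -
  have "((1/2 :: real) ^ n)\<^sup>2 = ((1/2)\<^sup>2) ^ n"
    by (simp only: power_mult[symmetric] mult.commute)
  then show ?thesis by (simp add: power2_eq_square)
qed

text \<open>The limit \<open>w\<close> of a minimising sequence of \<open>norm (g + v)\<close> over \<open>v \<in> V\<close>: the parallelogram law
  makes the sequence Cauchy, and the first variation makes \<open>g + w\<close> orthogonal to \<open>V\<close>. So \<open>- w\<close> is
  the projection of \<open>g\<close> onto the closure of \<open>V\<close>.\<close>

theorem L2_projection:
  fixes V :: "('a \<Rightarrow> 'b::euclidean_space) set"
  assumes V: "\<And>v. v \<in> V \<Longrightarrow> square_integrable M v"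
    and g: "square_integrable M g"
    and zero: "(\<lambda>x. 0) \<in> V"
    and comb: "\<And>u v c. u \<in> V \<Longrightarrow> v \<in> V \<Longrightarrow> (\<lambda>x. u x + c *\<^sub>R v x) \<in> V"
  obtains v w where "\<And>n. v n \<in> V" "square_integrable M w" "AE x in M. (\<lambda>n. v n x) \<longlonglongrightarrow> w x"
    "(\<lambda>n. \<integral>x. (norm (w x - v n x))\<^sup>2 \<partial>M) \<longlonglongrightarrow> 0"
    "\<And>u. u \<in> V \<Longrightarrow> (\<integral>x. (g x + w x) \<bullet> u x \<partial>M) = 0"
proof -
  define Q where "Q v = (\<integral>x. (norm (g x + v x))\<^sup>2 \<partial>M)" for v
  define m where "m = (INF v\<in>V. Q v)"
  have Q0: "0 \<le> Q v" for v by (simp add: Q_def)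
  have bdd: "bdd_below (Q ` V)" using Q0 by (intro bdd_belowI2[of _ 0]) auto
  have mle: "m \<le> Q v" if "v \<in> V" for v
    unfolding m_def using that bdd by (intro cINF_lower) auto
  have "\<exists>v\<in>V. Q v < m + (1/4) ^ n" for n
    using cInf_lessD[of "Q ` V" "m + (1/4) ^ n"] zero by (auto simp: m_def)
  then obtain v where v: "\<And>n. v n \<in> V" and Qv: "\<And>n. Q (v n) < m + (1/4) ^ n" by metis
  have sv: "square_integrable M (v n)" for n using V v by auto
  have gv: "square_integrable M (\<lambda>x. g x + v n x)" for n using g sv by (intro square_integrable_add)
  have lev: "(\<integral>x. (norm (v k x - v n x))\<^sup>2 \<partial>M) \<le> 4 * (1/4) ^ n" if "n \<le> k" for n k
  proof -
    let ?mid = "\<lambda>x. (1/2) *\<^sub>R v n x + (1/2) *\<^sub>R v k x"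
    have "(\<lambda>x. 0 + (1/2) *\<^sub>R v n x) \<in> V" by (intro comb zero v)
    from comb[OF this v, of "1/2" k] have midV: "?mid \<in> V" by simp
    have gm: "square_integrable M (\<lambda>x. g x + ?mid x)"
      by (rule square_integrable_add[OF g V[OF midV]])
    have aux: "2 * a + 2 * b - 4 * c \<le> 2 * (l + s) + 2 * (l + t) - 4 * l"
      if "a < l + s" "b < l + t" "l \<le> c" for a b c l s t :: real
      using that by (simp add: algebra_simps)
    have "(norm (v k x - v n x))\<^sup>2 =
      2 * (norm (g x + v n x))\<^sup>2 + 2 * (norm (g x + v k x))\<^sup>2 - 4 * (norm (g x + ?mid x))\<^sup>2" for x
      by (simp add: power2_norm_eq_inner inner_add_left inner_add_right inner_diff_left
          inner_diff_right inner_commute field_simps)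
    then have "(\<integral>x. (norm (v k x - v n x))\<^sup>2 \<partial>M) = 2 * Q (v n) + 2 * Q (v k) - 4 * Q ?mid"
      unfolding Q_def using gv[of n] gv[of k] gm by (simp add: square_integrable_def)
    also have "\<dots> \<le> 2 * (m + (1/4) ^ n) + 2 * (m + (1/4) ^ k) - 4 * m"
      by (rule aux[OF Qv Qv mle[OF midV]])
    also have "\<dots> \<le> 4 * (1/4) ^ n" using power_decreasing[OF that, of "1/4::real"] by simp
    finally show ?thesis .
  qed
  obtain w where w: "square_integrable M w" "AE x in M. (\<lambda>n. v n x) \<longlonglongrightarrow> w x"
    and lw: "\<And>n. (\<integral>x. (norm (w x - v n x))\<^sup>2 \<partial>M) \<le> 4 * (1/4) ^ n"
    using rapidly_Cauchy_L2_limit[OF sv lev] by blast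
  have pow0: "(\<lambda>n. (1/4) ^ n :: real) \<longlonglongrightarrow> 0" "(\<lambda>n. (1/2) ^ n :: real) \<longlonglongrightarrow> 0"
    by (rule LIMSEQ_power_zero, simp)+
  have lim0: "(\<lambda>n. \<integral>x. (norm (w x - v n x))\<^sup>2 \<partial>M) \<longlonglongrightarrow> 0"
  proof (rule real_tendsto_sandwich[where f = "\<lambda>_. 0" and h = "\<lambda>n. 4 * (1/4) ^ n"])
    show "(\<lambda>n. 4 * (1/4) ^ n :: real) \<longlonglongrightarrow> 0" using tendsto_mult_left[OF pow0(1), of 4] by simp
    show "\<forall>\<^sub>F n in sequentially. (\<integral>x. (norm (w x - v n x))\<^sup>2 \<partial>M) \<le> 4 * (1/4) ^ n"
      by (intro always_eventually allI lw)
    show "\<forall>\<^sub>F n in sequentially. (0::real) \<le> (\<integral>x. (norm (w x - v n x))\<^sup>2 \<partial>M)"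
      by (intro always_eventually allI integral_nonneg_AE AE_I2 zero_le_power2)
  qed simp
  have orth: "(\<integral>x. (g x + w x) \<bullet> u x \<partial>M) = 0" if u: "u \<in> V" for u
  proof -
    define N where "N = (\<integral>x. (norm (u x))\<^sup>2 \<partial>M)"
    define I where "I = (\<integral>x. (g x + w x) \<bullet> u x \<partial>M)"
    have N0: "0 \<le> N" by (simp add: N_def)
    have su: "square_integrable M u" using V u by auto
    \<comment> \<open>Near-minimality of \<open>v n\<close> gives near-orthogonality: a multiple of \<open>u\<close> of
      size \<open>(1/2) ^ n\<close> cannot lower the value by more than \<open>(1/4) ^ n\<close>.\<close>
    have small: "\<bar>\<integral>x. (g x + v n x) \<bullet> u x \<partial>M\<bar> \<le> (1/2) ^ n * (1 + N)" for n
    proof -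
      define J where "J = (\<integral>x. (g x + v n x) \<bullet> u x \<partial>M)"
      have var: "- ((1/4) ^ n) \<le> 2 * c * J + c\<^sup>2 * N" for c
      proof -
        have "m \<le> Q (\<lambda>x. v n x + c *\<^sub>R u x)" by (intro mle comb v u)
        also have "\<dots> = Q (v n) + 2 * c * J + c\<^sup>2 * N"
          using integral_norm_add_sq[OF gv[of n] su, of c] by (simp add: Q_def N_def J_def add.assoc)
        finally show ?thesis using Qv[of n] by linarith
      qed
      define r where "r = ((1/2) ^ n :: real)"
      have r: "0 < r" "(1/4) ^ n = r\<^sup>2" by (simp_all add: r_def quarter_power)
      have "r * (2 * J) \<le> r * (r * (1 + N))" "r * (- 2 * J) \<le> r * (r * (1 + N))"
        using var[of r] var[of "-r"] by (simp_all add: r(2) algebra_simps power2_eq_square)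
      then have "2 * J \<le> r * (1 + N)" "- 2 * J \<le> r * (1 + N)"
        using r(1) by (blast dest: mult_left_le_imp_le)+
      then have "\<bar>J\<bar> * 2 \<le> r * (1 + N)" by (simp add: abs_if)
      also have "\<dots> \<le> 2 * (r * (1 + N))" using r N0 by simp
      finally have "\<bar>J\<bar> \<le> r * (1 + N)" by simp
      then show ?thesis by (simp add: r_def J_def)
    qed
    have near: "\<bar>I - (\<integral>x. (g x + v n x) \<bullet> u x \<partial>M)\<bar> \<le> (1/2) ^ n * (2 + N)" for n
    proof -
      have sd: "square_integrable M (\<lambda>x. w x - v n x)" by (intro square_integrable_diff w sv)
      have gw: "square_integrable M (\<lambda>x. g x + w x)" by (intro square_integrable_add w g)
      define r where "r = ((1/2) ^ n :: real)"
      have r: "0 < r" "(1/4) ^ n = r\<^sup>2" by (simp_all add: r_def quarter_power)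
      have "I - (\<integral>x. (g x + v n x) \<bullet> u x \<partial>M) =
        (\<integral>x. (g x + w x) \<bullet> u x - (g x + v n x) \<bullet> u x \<partial>M)"
        unfolding I_def using gw gv[of n] su
        by (intro Bochner_Integration.integral_diff[symmetric] integrable_inner)
      also have "\<dots> = (\<integral>x. (w x - v n x) \<bullet> u x \<partial>M)"
        by (intro Bochner_Integration.integral_cong) (auto simp: inner_add_left inner_diff_left)
      also have "\<bar>\<dots>\<bar> \<le> (\<integral>x. \<bar>(w x - v n x) \<bullet> u x\<bar> \<partial>M)" by (rule integral_abs_bound)
      also have "\<dots> \<le> (\<integral>x. (norm (w x - v n x))\<^sup>2 / (2 * r) + r / 2 * (norm (u x))\<^sup>2 \<partial>M)"
        using sd su abs_inner_le_AM_GM[OF r(1)] integrable_inner[OF sd su]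
        by (intro integral_mono) (auto simp: square_integrable_def)
      also have "\<dots> = (\<integral>x. (norm (w x - v n x))\<^sup>2 \<partial>M) / (2 * r) + r / 2 * N"
        using sd su by (simp add: square_integrable_def N_def)
      also have "\<dots> \<le> (4 * r\<^sup>2) / (2 * r) + r / 2 * N"
        using lw[of n] r by (intro add_mono divide_right_mono) auto
      also have "\<dots> \<le> r * (2 + N)" using r N0 by (simp add: power2_eq_square field_simps)
      finally show ?thesis by (simp add: r_def)
    qed
    have "\<bar>I\<bar> \<le> (1/2) ^ n * (3 + 2 * N)" for n
      using small[of n] near[of n] by (simp add: algebra_simps)
    moreover have "(\<lambda>n. (1/2) ^ n * (3 + 2 * N)) \<longlonglongrightarrow> 0"
      using tendsto_mult_right[OF pow0(2)] by force
    ultimately have "\<bar>I\<bar> \<le> 0"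
      by (intro LIMSEQ_le_const[where X = "\<lambda>n. (1/2) ^ n * (3 + 2 * N)"]) auto
    then show ?thesis by (simp add: I_def)
  qed
  show ?thesis by (rule that[OF v w lim0 orth])
qed

section \<open>Nearest-neighbour configurations on the lattice\<close>

lemma rvec_add: "rvec (x + y) = rvec x + rvec y"
  and rvec_diff: "rvec (x - y) = rvec x - rvec y"
  and rvec_minus: "rvec (- x) = - rvec x"
  and rvec_0 [simp]: "rvec 0 = 0"
  by (simp_all add: rvec_def vec_eq_iff)

lemma rvec_axis: "rvec (axis i c) = axis i (real_of_int c)"
  by (simp add: rvec_def vec_eq_iff axis_def)

definition unit_sites :: "'d::finite site set" where
  "unit_sites = {e. norm (rvec e) = 1}"

text \<open>The unit sites, indexed by axis and sign. The index type is finite, so that functions of a unit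
  site become vectors of a Euclidean space.\<close>

definition unit_site :: "'d::finite \<times> bool \<Rightarrow> 'd site" where
  "unit_site j = axis (fst j) (if snd j then 1 else - 1)"

lemma norm_axis_real: "norm (axis i (c::real)) = \<bar>c\<bar>"
  by (simp add: norm_eq_sqrt_inner inner_axis_axis)

lemma unit_site_in: "unit_site j \<in> unit_sites"
  by (simp add: unit_site_def unit_sites_def rvec_axis norm_axis_real)

lemma unit_sitesE:
  assumes "(e::'d::finite site) \<in> unit_sites"
  obtains j where "e = unit_site j"
proof -
  have "(norm (rvec e))\<^sup>2 = real_of_int (\<Sum>i\<in>UNIV. (e $ i)\<^sup>2)"
    unfolding power2_norm_eq_inner by (simp add: inner_vec_def rvec_def power2_eq_square)
  with assms have "real_of_int (\<Sum>i\<in>UNIV. (e $ i)\<^sup>2) = 1" by (simp add: unit_sites_def)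
  then have sum1: "(\<Sum>i\<in>UNIV. (e $ i)\<^sup>2) = 1" by linarith
  then have "\<exists>i. e $ i \<noteq> 0" by (rule contrapos_pp) simp
  then obtain i where i: "e $ i \<noteq> 0" by blast
  have split: "(e $ i)\<^sup>2 + (\<Sum>k\<in>UNIV - {i}. (e $ k)\<^sup>2) = 1"
    using sum1 by (simp add: sum.remove[of UNIV i])
  have ge: "1 \<le> (e $ i)\<^sup>2"
    using i zero_less_power2[of "e $ i"] by linarith
  have rest: "0 \<le> (\<Sum>k\<in>UNIV - {i}. (e $ k)\<^sup>2)" by (intro sum_nonneg) auto
  with split ge have one: "(e $ i)\<^sup>2 = 1" and zero: "(\<Sum>k\<in>UNIV - {i}. (e $ k)\<^sup>2) = 0"
    by linarith+
  from zero have "e $ k = 0" if "k \<noteq> i" for k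
    using that by (subst (asm) sum_nonneg_eq_0_iff) auto
  moreover have "e $ i = 1 \<or> e $ i = -1" using one by (simp add: power2_eq_1_iff)
  ultimately have "e = unit_site (i, e $ i = 1)"
    by (auto simp: unit_site_def vec_eq_iff axis_def)
  then show ?thesis by (rule that)
qed

lemma bij_betw_unit_site: "bij_betw unit_site UNIV (unit_sites :: 'd::finite site set)"
  unfolding bij_betw_def
proof
  show "inj (unit_site :: 'd \<times> bool \<Rightarrow> 'd site)"
    by (auto simp: inj_def unit_site_def axis_eq_axis split: if_splits)
  show "range unit_site = (unit_sites :: 'd site set)"
    using unit_site_in by (auto elim: unit_sitesE)
qed

lemma finite_unit_sites [simp]: "finite (unit_sites :: 'd::finite site set)"
  using bij_betw_finite[OF bij_betw_unit_site] by simp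

lemma minus_in_unit_sites [simp]: "- e \<in> unit_sites \<longleftrightarrow> e \<in> unit_sites"
  by (simp add: unit_sites_def rvec_minus)

lemma finite_site_box:
  assumes "finite A"
  shows "finite {x :: 'd::finite site. \<forall>i. x $ i \<in> A}"
proof (rule finite_subset)
  show "{x :: 'd site. \<forall>i. x $ i \<in> A} \<subseteq> vec_lambda ` (UNIV \<rightarrow>\<^sub>E A)"
  proof
    fix x :: "'d site" assume "x \<in> {x. \<forall>i. x $ i \<in> A}"
    then have "vec_nth x \<in> UNIV \<rightarrow>\<^sub>E A" by auto
    then show "x \<in> vec_lambda ` (UNIV \<rightarrow>\<^sub>E A)" by (rule rev_image_eqI) simp
  qed
  show "finite (vec_lambda ` (UNIV \<rightarrow>\<^sub>E A) :: 'd site set)"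
    using assms by (intro finite_imageI finite_PiE) auto
qed

lemma finite_site_ball: "finite {x :: 'd::finite site. norm (rvec x) \<le> r}"
proof (rule finite_subset)
  show "{x :: 'd site. norm (rvec x) \<le> r} \<subseteq> {x. \<forall>i. x $ i \<in> {- \<lceil>r\<rceil>..\<lceil>r\<rceil>}}"
  proof safe
    fix x :: "'d site" and i assume "norm (rvec x) \<le> r"
    then have "\<bar>real_of_int (x $ i)\<bar> \<le> r"
      using component_le_norm_cart[of "rvec x" i] by (simp add: rvec_def)
    then have "real_of_int \<bar>x $ i\<bar> \<le> real_of_int \<lceil>r\<rceil>" using le_of_int_ceiling[of r] by linarith
    then have "\<bar>x $ i\<bar> \<le> \<lceil>r\<rceil>" by (simp only: of_int_le_iff)
    then show "x $ i \<in> {- \<lceil>r\<rceil>..\<lceil>r\<rceil>}" unfolding atLeastAtMost_iff by linarith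
  qed
qed (rule finite_site_box, simp)

text \<open>The lattice is connected: a statement that is stable under unit steps spreads from the origin.
  Each step towards the origin lowers the \<open>l\<^sup>1\<close> norm.\<close>

lemma site_induct [case_names zero step]:
  fixes x :: "'d::finite site"
  assumes zero: "S 0" and step: "\<And>x e. S x \<Longrightarrow> e \<in> unit_sites \<Longrightarrow> S (x + e)"
  shows "S x"
proof (induction "\<Sum>i\<in>UNIV. nat \<bar>x $ i\<bar>" arbitrary: x rule: less_induct)
  case less
  show ?case
  proof (cases "x = 0")
    case False
    then obtain i where i: "x $ i \<noteq> 0" by (auto simp: vec_eq_iff)
    define e :: "'d site" where "e = unit_site (i, 0 < x $ i)"
    have "(\<Sum>k\<in>UNIV. nat \<bar>(x - e) $ k\<bar>) < (\<Sum>k\<in>UNIV. nat \<bar>x $ k\<bar>)"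
    proof (rule sum_strict_mono_ex1)
      show "\<exists>k\<in>UNIV. nat \<bar>(x - e) $ k\<bar> < nat \<bar>x $ k\<bar>"
        using i by (intro bexI[of _ i]) (auto simp: e_def unit_site_def axis_def)
    qed (use i in \<open>auto simp: e_def unit_site_def axis_def\<close>)
    from less[OF this] have "S (x - e + e)" by (intro step) (simp_all add: e_def unit_site_in)
    then show ?thesis by simp
  qed (use zero in simp)
qed

lemma nn_confsD:
  assumes "\<omega> \<in> nn_confs"
  shows "0 \<le> \<omega> (x, y)" "\<omega> (x, y) = \<omega> (y, x)" "y - x \<notin> unit_sites \<Longrightarrow> \<omega> (x, y) = 0"
  using assms by (auto simp: nn_confs_def unit_sites_def rvec_diff norm_minus_commute)

lemma translate_0 [simp]: "translate 0 \<omega> = \<omega>"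
  by (simp add: translate_def)

lemma translate_translate: "translate z (translate y \<omega>) = translate (z + y) \<omega>"
  by (simp add: translate_def fun_eq_iff add.assoc)

lemma translate_in_nn_confs: "\<omega> \<in> nn_confs \<Longrightarrow> translate z \<omega> \<in> nn_confs"
  by (auto simp: translate_def nn_confs_def)

lemma translate_apply: "translate z \<omega> (x, y) = \<omega> (x + z, y + z)"
  by (simp add: translate_def)

lemma measurable_conf_space_coord: "(\<lambda>\<omega>. \<omega> xy) \<in> borel_measurable conf_space"
  unfolding conf_space_def by (intro measurable_restrict_space1 measurable_component_singleton) auto

lemma measurable_translate_conf_space: "translate z \<in> conf_space \<rightarrow>\<^sub>M (conf_space :: 'd::finite conf measure)"
  unfolding conf_space_def
proof (rule measurable_restrict_space3)
  show "translate z \<in> nn_confs \<rightarrow> nn_confs" by (auto intro: translate_in_nn_confs)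
  show "translate z \<in> PiM UNIV (\<lambda>_. borel) \<rightarrow>\<^sub>M PiM UNIV (\<lambda>_. borel :: real measure)"
    by (rule measurable_PiM_single')
       (auto simp: translate_def space_PiM split: prod.split intro!: measurable_component_singleton)
qed

lemma infsum_neighbours:
  fixes g :: "'d::finite site \<Rightarrow> 'b::{comm_monoid_add, t2_space}"
  assumes "\<And>y. y - x \<notin> unit_sites \<Longrightarrow> g y = 0"
  shows "infsum g UNIV = (\<Sum>e\<in>unit_sites. g (x + e))"
proof -
  have "infsum g UNIV = infsum g ((+) x ` unit_sites)"
    using assms by (intro infsum_cong_neutral) (force simp: image_iff algebra_simps)+
  also have "\<dots> = (\<Sum>e\<in>unit_sites. g (x + e))" by (simp add: sum.reindex)
  finally show ?thesis .
qed

lemma total_conductance_eq: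
  "\<omega> \<in> nn_confs \<Longrightarrow> total_conductance \<omega> x = (\<Sum>e\<in>unit_sites. \<omega> (x, x + e))"
  unfolding total_conductance_def by (intro infsum_neighbours nn_confsD)

lemma generator_eq:
  assumes "\<omega> \<in> nn_confs"
  shows "generator \<omega> f x =
    (\<Sum>e\<in>unit_sites. \<omega> (x, x + e) *\<^sub>R (f (x + e) - f x)) /\<^sub>R total_conductance \<omega> x"
  unfolding generator_def
  using nn_confsD(3)[OF assms] by (subst infsum_neighbours[where x = x]) simp_all

lemma generator_eq_0_iff:
  assumes \<omega>: "\<omega> \<in> nn_confs" and pos: "\<And>e. e \<in> unit_sites \<Longrightarrow> 0 < \<omega> (x, x + e)"
  shows "generator \<omega> f x = 0 \<longleftrightarrow> (\<Sum>e\<in>unit_sites. \<omega> (x, x + e) *\<^sub>R (f (x + e) - f x)) = 0"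
proof -
  have "unit_sites \<noteq> ({} :: 'a site set)" using unit_site_in by blast
  then have "0 < total_conductance \<omega> x"
    using pos by (simp add: total_conductance_eq[OF \<omega>] sum_pos)
  then show ?thesis by (simp add: generator_eq[OF \<omega>])
qed

text \<open>Weighting by the square roots of the conductances identifies the energy form at the origin with
  the Euclidean inner product. The energy seminorm then becomes an ordinary \<open>L\<^sup>2\<close> norm over the law.\<close>

definition edge_vec :: "'d::finite conf \<Rightarrow> ('d site \<Rightarrow> real ^ 'd) \<Rightarrow> (real ^ 'd) ^ ('d \<times> bool)" where
  "edge_vec \<omega> u = (\<chi> j. sqrt (\<omega> (0, unit_site j)) *\<^sub>R u (unit_site j))"

lemma edge_vec_inner:
  assumes "\<omega> \<in> nn_confs"
  shows "edge_vec \<omega> u \<bullet> edge_vec \<omega> v = (\<Sum>e\<in>unit_sites. \<omega> (0, e) * (u e \<bullet> v e))"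
proof -
  have "edge_vec \<omega> u \<bullet> edge_vec \<omega> v =
    (\<Sum>j\<in>UNIV. \<omega> (0, unit_site j) * (u (unit_site j) \<bullet> v (unit_site j)))"
    unfolding inner_vec_def[of "edge_vec \<omega> u"]
    using nn_confsD(1)[OF assms] by (intro sum.cong) (simp_all add: edge_vec_def flip: mult.assoc)
  also have "\<dots> = (\<Sum>e\<in>unit_sites. \<omega> (0, e) * (u e \<bullet> v e))"
    by (rule sum.reindex_bij_betw[OF bij_betw_unit_site])
  finally show ?thesis .
qed

lemma edge_vec_norm:
  assumes "\<omega> \<in> nn_confs"
  shows "(norm (edge_vec \<omega> u))\<^sup>2 = (\<Sum>e\<in>unit_sites. \<omega> (0, e) * (norm (u e))\<^sup>2)"
  unfolding power2_norm_eq_inner edge_vec_inner[OF assms] ..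

lemma edge_vec_linear: "edge_vec \<omega> (\<lambda>e. u e + c *\<^sub>R v e) = edge_vec \<omega> u + c *\<^sub>R edge_vec \<omega> v"
  by (simp add: edge_vec_def vec_eq_iff scaleR_add_right)

lemma edge_vec_add: "edge_vec \<omega> (\<lambda>e. u e + v e) = edge_vec \<omega> u + edge_vec \<omega> v"
  using edge_vec_linear[of \<omega> u 1 v] by simp

lemma edge_vec_diff: "edge_vec \<omega> (\<lambda>e. u e - v e) = edge_vec \<omega> u - edge_vec \<omega> v"
  using edge_vec_linear[of \<omega> u "-1" v] by simp

lemma grad_cocycle: "grad h \<omega> (x + y) = grad h \<omega> x + grad h (translate x \<omega>) y"
  by (simp add: grad_def translate_translate add.commute)

section \<open>Integration by parts for a stationary law\<close>

text \<open>Up to the factor \<open>1 / \<pi>(0)\<close> this is the generator at the origin, applied to a function that vanishes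
  there.\<close>

definition flux :: "'d::finite conf \<Rightarrow> ('d site \<Rightarrow> real ^ 'd) \<Rightarrow> real ^ 'd" where
  "flux \<omega> f = (\<Sum>e\<in>unit_sites. \<omega> (0, e) *\<^sub>R f e)"

locale stationary_conductances =
  fixes P :: "'d::finite conf measure"
  assumes law: "conductance_law P"
    and stat: "stationary P"
    and pos: "\<And>e. e \<in> unit_sites \<Longrightarrow> AE \<omega> in P. 0 < \<omega> (0, e)"
    and int: "\<And>e. e \<in> unit_sites \<Longrightarrow> integrable P (\<lambda>\<omega>. \<omega> (0, e))"
begin

sublocale prob_space P
  using law by (simp add: conductance_law_def)

lemma sets_P: "sets P = sets conf_space"
  using law by (simp add: conductance_law_def)

lemma space_P: "space P = nn_confs"
  using sets_eq_imp_space_eq[OF sets_P]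
  by (simp add: conf_space_def space_restrict_space space_PiM)

lemma measurable_coord [measurable]: "(\<lambda>\<omega>. \<omega> (x, y)) \<in> borel_measurable P"
  unfolding measurable_cong_sets[OF sets_P refl] by (rule measurable_conf_space_coord)

lemma measurable_translate [measurable]: "translate z \<in> measurable P P"
  unfolding measurable_cong_sets[OF sets_P sets_P] by (rule measurable_translate_conf_space)

lemma distr_translate: "distr P P (translate z) = P"
  using stat by (simp add: stationary_def)

lemma AE_translate:
  assumes "AE \<omega> in P. Q \<omega>"
  shows "AE \<omega> in P. Q (translate z \<omega>)"
proof (rule AE_distrD[OF measurable_translate])
  show "AE \<omega> in distr P P (translate z). Q \<omega>" unfolding distr_translate by (rule assms)
qed

lemma AE_translate_all:
  assumes "AE \<omega> in P. Q \<omega>"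
  shows "AE \<omega> in P. \<forall>z. Q (translate z \<omega>)"
  unfolding AE_all_countable using AE_translate[OF assms] by blast

lemma integral_translate:
  fixes f :: "'d conf \<Rightarrow> real"
  assumes "f \<in> borel_measurable P"
  shows "(\<integral>\<omega>. f (translate z \<omega>) \<partial>P) = (\<integral>\<omega>. f \<omega> \<partial>P)"
  using integral_distr[OF measurable_translate assms, of z] by (simp add: distr_translate)

lemma integrable_translate:
  fixes f :: "'d conf \<Rightarrow> real"
  assumes "integrable P f"
  shows "integrable P (\<lambda>\<omega>. f (translate z \<omega>))"
proof (rule integrable_distr[OF measurable_translate])
  show "integrable (distr P P (translate z)) f" unfolding distr_translate by (rule assms)
qed

lemma measurable_grad [measurable]:
  assumes [measurable]: "h \<in> borel_measurable P"
  shows "(\<lambda>\<omega>. grad h \<omega> x) \<in> borel_measurable P"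
  unfolding grad_def by measurable

lemma measurable_edge_vec:
  assumes [measurable]: "\<And>e. (\<lambda>\<omega>. u \<omega> e) \<in> borel_measurable P"
  shows "(\<lambda>\<omega>. edge_vec \<omega> (u \<omega>)) \<in> borel_measurable P"
proof -
  have "(\<lambda>\<omega>. edge_vec \<omega> (u \<omega>) \<bullet> b) \<in> borel_measurable P" if "b \<in> Basis" for b
  proof -
    have "\<exists>j c. b = axis j c" using \<open>b \<in> Basis\<close> by (subst (asm) Basis_vec_def) blast
    then obtain j c where b: "b = axis j c" by blast
    have eq: "edge_vec \<omega> (u \<omega>) \<bullet> b = (sqrt (\<omega> (0, unit_site j)) *\<^sub>R u \<omega> (unit_site j)) \<bullet> c" for \<omega>
      unfolding b inner_axis by (simp only: edge_vec_def vec_lambda_beta)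
    show ?thesis unfolding eq by measurable
  qed
  then show ?thesis by (subst borel_measurable_euclidean_space) blast
qed

lemma energy_eq:
  "energy P u = (\<integral>\<^sup>+ \<omega>. ennreal ((norm (edge_vec \<omega> (u \<omega>)))\<^sup>2) \<partial>P)"
  unfolding energy_def
proof (rule nn_integral_cong)
  fix \<omega> assume "\<omega> \<in> space P"
  then have \<omega>: "\<omega> \<in> nn_confs" by (simp add: space_P)
  have "(\<Sum>\<^sub>\<infinity>x. ennreal (\<omega> (0, x) * (norm (u \<omega> x))\<^sup>2)) =
    (\<Sum>e\<in>unit_sites. ennreal (\<omega> (0, e) * (norm (u \<omega> e))\<^sup>2))"
    using nn_confsD(3)[OF \<omega>, of _ 0] by (subst infsum_neighbours[of 0]) auto
  also have "\<dots> = ennreal ((norm (edge_vec \<omega> (u \<omega>)))\<^sup>2)"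
    unfolding edge_vec_norm[OF \<omega>] using nn_confsD(1)[OF \<omega>] by (intro sum_ennreal) simp
  finally show "(\<Sum>\<^sub>\<infinity>x. ennreal (\<omega> (0, x) * (norm (u \<omega> x))\<^sup>2)) = ennreal ((norm (edge_vec \<omega> (u \<omega>)))\<^sup>2)" .
qed

lemma square_integrable_edge_vec_iff:
  assumes "\<And>e. (\<lambda>\<omega>. u \<omega> e) \<in> borel_measurable P"
  shows "square_integrable P (\<lambda>\<omega>. edge_vec \<omega> (u \<omega>)) \<longleftrightarrow> energy P u < \<infinity>"
proof -
  have [measurable]: "(\<lambda>\<omega>. edge_vec \<omega> (u \<omega>)) \<in> borel_measurable P"
    by (rule measurable_edge_vec[OF assms])
  show ?thesis
    unfolding square_integrable_def energy_eq integrable_iff_bounded by simp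
qed

lemma energy_eq_integral:
  assumes "square_integrable P (\<lambda>\<omega>. edge_vec \<omega> (u \<omega>))"
  shows "energy P u = ennreal (\<integral>\<omega>. (norm (edge_vec \<omega> (u \<omega>)))\<^sup>2 \<partial>P)"
  unfolding energy_eq using assms by (intro nn_integral_eq_integral) (auto simp: square_integrable_def)

lemma square_integrable_bounded:
  assumes meas: "\<And>e. (\<lambda>\<omega>. u \<omega> e) \<in> borel_measurable P"
    and B: "\<And>\<omega> e. \<omega> \<in> space P \<Longrightarrow> e \<in> unit_sites \<Longrightarrow> norm (u \<omega> e) \<le> B"
  shows "square_integrable P (\<lambda>\<omega>. edge_vec \<omega> (u \<omega>))"
  unfolding square_integrable_def
proof
  show [measurable]: "(\<lambda>\<omega>. edge_vec \<omega> (u \<omega>)) \<in> borel_measurable P"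
    by (rule measurable_edge_vec[OF meas])
  show "integrable P (\<lambda>\<omega>. (norm (edge_vec \<omega> (u \<omega>)))\<^sup>2)"
  proof (rule Bochner_Integration.integrable_bound)
    show "integrable P (\<lambda>\<omega>. \<Sum>e\<in>unit_sites. \<omega> (0, e) * B\<^sup>2)"
      using int by (intro Bochner_Integration.integrable_sum) simp
    show "AE \<omega> in P. norm ((norm (edge_vec \<omega> (u \<omega>)))\<^sup>2) \<le> norm (\<Sum>e\<in>unit_sites. \<omega> (0, e) * B\<^sup>2)"
    proof (rule AE_I2)
      fix \<omega> assume sp: "\<omega> \<in> space P"
      then have \<omega>: "\<omega> \<in> nn_confs" by (simp add: space_P)
      have "(norm (edge_vec \<omega> (u \<omega>)))\<^sup>2 \<le> (\<Sum>e\<in>unit_sites. \<omega> (0, e) * B\<^sup>2)"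
        unfolding edge_vec_norm[OF \<omega>]
        by (intro sum_mono mult_left_mono power_mono B sp nn_confsD(1)[OF \<omega>]) auto
      then show "norm ((norm (edge_vec \<omega> (u \<omega>)))\<^sup>2) \<le> norm (\<Sum>e\<in>unit_sites. \<omega> (0, e) * B\<^sup>2)"
        by simp
    qed
  qed measurable
qed

lemma integrable_weighted:
  assumes meas [measurable]: "\<And>e. (\<lambda>\<omega>. u \<omega> e) \<in> borel_measurable P"
    and sq: "square_integrable P (\<lambda>\<omega>. edge_vec \<omega> (u \<omega>))" and e: "e \<in> unit_sites"
  shows "integrable P (\<lambda>\<omega>. \<omega> (0, e) *\<^sub>R u \<omega> e)"
proof (rule Bochner_Integration.integrable_bound)
  show "integrable P (\<lambda>\<omega>. \<omega> (0, e) + (norm (edge_vec \<omega> (u \<omega>)))\<^sup>2)"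
    using sq int[OF e] by (simp add: square_integrable_def)
  show "AE \<omega> in P. norm (\<omega> (0, e) *\<^sub>R u \<omega> e) \<le> norm (\<omega> (0, e) + (norm (edge_vec \<omega> (u \<omega>)))\<^sup>2)"
  proof (rule AE_I2)
    fix \<omega> assume sp: "\<omega> \<in> space P"
    then have \<omega>: "\<omega> \<in> nn_confs" by (simp add: space_P)
    have le: "r \<le> 1 + r\<^sup>2" for r :: real
      using zero_le_power2[of "r - 1/2"] unfolding power2_diff by (simp add: power2_eq_square)
    have "norm (\<omega> (0, e) *\<^sub>R u \<omega> e) \<le> \<omega> (0, e) * (1 + (norm (u \<omega> e))\<^sup>2)"
      using nn_confsD(1)[OF \<omega>, of 0 e] le by (auto intro!: mult_left_mono)
    also have "\<dots> = \<omega> (0, e) + \<omega> (0, e) * (norm (u \<omega> e))\<^sup>2" by (simp add: algebra_simps)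
    also have "\<dots> \<le> \<omega> (0, e) + (norm (edge_vec \<omega> (u \<omega>)))\<^sup>2"
      unfolding edge_vec_norm[OF \<omega>] using nn_confsD(1)[OF \<omega>] e
      by (intro add_left_mono member_le_sum) auto
    finally show "norm (\<omega> (0, e) *\<^sub>R u \<omega> e) \<le> norm (\<omega> (0, e) + (norm (edge_vec \<omega> (u \<omega>)))\<^sup>2)"
      by simp
  qed
qed measurable

text \<open>Integration by parts. In \<open>C(0,e) G(e) \<bullet> (h \<circ> \<tau>\<^sub>e - h)\<close> the first half is, by the symmetry of the
  conductances and the antisymmetry of \<open>G\<close>, the shift by \<open>e\<close> of the second half for the edge
  \<open>- e\<close>. By stationarity both halves contribute minus the integral of the flux against \<open>h\<close>.\<close>

lemma integral_flux_grad:
  assumes meas [measurable]: "\<And>e. (\<lambda>\<omega>. G \<omega> e) \<in> borel_measurable P"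
    and anti: "AE \<omega> in P. \<forall>e\<in>unit_sites. G \<omega> e = - G (translate e \<omega>) (- e)"
    and sq: "square_integrable P (\<lambda>\<omega>. edge_vec \<omega> (G \<omega>))"
    and h [measurable]: "h \<in> borel_measurable P" and B: "\<And>\<omega>. \<omega> \<in> space P \<Longrightarrow> norm (h \<omega>) \<le> B"
  shows "(\<integral>\<omega>. edge_vec \<omega> (G \<omega>) \<bullet> edge_vec \<omega> (grad h \<omega>) \<partial>P) = - 2 * (\<integral>\<omega>. flux \<omega> (G \<omega>) \<bullet> h \<omega> \<partial>P)"
proof -
  define F where "F e \<omega> = (\<omega> (0, e) *\<^sub>R G \<omega> e) \<bullet> h \<omega>" for e \<omega>
  have [measurable]: "F e \<in> borel_measurable P" for e unfolding F_def by measurable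
  \<comment> \<open>The two halves are integrated separately, so each has to be integrable.\<close>
  have F_int: "integrable P (F e)" if e: "e \<in> unit_sites" for e
  proof (rule Bochner_Integration.integrable_bound)
    show "integrable P (\<lambda>\<omega>. B * norm (\<omega> (0, e) *\<^sub>R G \<omega> e))"
      using integrable_weighted[OF meas sq e] by (intro integrable_mult_right integrable_norm)
    show "AE \<omega> in P. norm (F e \<omega>) \<le> norm (B * norm (\<omega> (0, e) *\<^sub>R G \<omega> e))"
    proof (rule AE_I2)
      fix \<omega> assume "\<omega> \<in> space P"
      have "norm (F e \<omega>) \<le> norm (\<omega> (0, e) *\<^sub>R G \<omega> e) * norm (h \<omega>)"
        unfolding F_def by (simp only: real_norm_def Cauchy_Schwarz_ineq2)
      also have "\<dots> \<le> norm (\<omega> (0, e) *\<^sub>R G \<omega> e) * B"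
        by (intro mult_left_mono B \<open>\<omega> \<in> space P\<close>) auto
      finally show "norm (F e \<omega>) \<le> norm (B * norm (\<omega> (0, e) *\<^sub>R G \<omega> e))"
        by (metis abs_ge_self mult.commute order_trans real_norm_def)
    qed
  qed measurable
  have "(\<integral>\<omega>. edge_vec \<omega> (G \<omega>) \<bullet> edge_vec \<omega> (grad h \<omega>) \<partial>P) =
    (\<integral>\<omega>. (\<Sum>e\<in>unit_sites. - F (- e) (translate e \<omega>) - F e \<omega>) \<partial>P)"
  proof (rule integral_cong_AE)
    show "AE \<omega> in P. edge_vec \<omega> (G \<omega>) \<bullet> edge_vec \<omega> (grad h \<omega>) =
      (\<Sum>e\<in>unit_sites. - F (- e) (translate e \<omega>) - F e \<omega>)"
      using anti AE_space
    proof eventually_elim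
      case (elim \<omega>)
      then have \<omega>: "\<omega> \<in> nn_confs" by (simp add: space_P)
      have "\<omega> (0, e) * (G \<omega> e \<bullet> grad h \<omega> e) = - F (- e) (translate e \<omega>) - F e \<omega>"
        if e: "e \<in> unit_sites" for e
      proof -
        have C: "translate e \<omega> (0, - e) = \<omega> (0, e)"
          using nn_confsD(2)[OF \<omega>, of e 0] by (simp add: translate_apply)
        have G: "G (translate e \<omega>) (- e) = - G \<omega> e" using elim(1) e by simp
        show ?thesis
          unfolding F_def C G grad_def by (simp add: inner_diff_right algebra_simps)
      qed
      then show ?case unfolding edge_vec_inner[OF \<omega>] by (intro sum.cong) auto
    qed
    show "(\<lambda>\<omega>. edge_vec \<omega> (G \<omega>) \<bullet> edge_vec \<omega> (grad h \<omega>)) \<in> borel_measurable P"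
      by (intro borel_measurable_inner measurable_edge_vec) measurable
  qed measurable
  also have "\<dots> = (\<Sum>e\<in>unit_sites. (\<integral>\<omega>. - F (- e) (translate e \<omega>) - F e \<omega> \<partial>P))"
    by (intro Bochner_Integration.integral_sum Bochner_Integration.integrable_diff
        Bochner_Integration.integrable_minus integrable_translate F_int) auto
  also have "\<dots> = (\<Sum>e\<in>unit_sites. - (\<integral>\<omega>. F (- e) \<omega> \<partial>P) - (\<integral>\<omega>. F e \<omega> \<partial>P))"
  proof (intro sum.cong refl)
    fix e :: "'d site" assume e: "e \<in> unit_sites"
    have "integrable P (\<lambda>\<omega>. F (- e) (translate e \<omega>))"
      using e by (intro integrable_translate F_int) simp
    then show "(\<integral>\<omega>. - F (- e) (translate e \<omega>) - F e \<omega> \<partial>P) = - (\<integral>\<omega>. F (- e) \<omega> \<partial>P) - (\<integral>\<omega>. F e \<omega> \<partial>P)"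
      using F_int[OF e] integral_translate[of "F (- e)" e] by simp
  qed
  also have "\<dots> = - (\<Sum>e\<in>unit_sites. (\<integral>\<omega>. F (- e) \<omega> \<partial>P)) - (\<Sum>e\<in>unit_sites. (\<integral>\<omega>. F e \<omega> \<partial>P))"
    by (simp add: sum_subtractf sum_negf)
  also have "(\<Sum>e\<in>unit_sites. (\<integral>\<omega>. F (- e) \<omega> \<partial>P)) = (\<Sum>e\<in>unit_sites. (\<integral>\<omega>. F e \<omega> \<partial>P))"
    by (rule sum.reindex_bij_witness[of _ uminus uminus]) auto
  also have "(\<Sum>e\<in>unit_sites. (\<integral>\<omega>. F e \<omega> \<partial>P)) = (\<integral>\<omega>. flux \<omega> (G \<omega>) \<bullet> h \<omega> \<partial>P)"
    unfolding flux_def inner_sum_left F_def[symmetric]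
    by (rule Bochner_Integration.integral_sum[symmetric]) (rule F_int)
  finally show ?thesis by simp
qed

lemma measurable_flux:
  assumes [measurable]: "\<And>e. (\<lambda>\<omega>. G \<omega> e) \<in> borel_measurable P"
  shows "(\<lambda>\<omega>. flux \<omega> (G \<omega>)) \<in> borel_measurable P"
  unfolding flux_def by measurable

lemma integrable_flux:
  assumes "\<And>e. (\<lambda>\<omega>. G \<omega> e) \<in> borel_measurable P" "square_integrable P (\<lambda>\<omega>. edge_vec \<omega> (G \<omega>))"
  shows "integrable P (\<lambda>\<omega>. flux \<omega> (G \<omega>))"
  unfolding flux_def by (intro Bochner_Integration.integrable_sum integrable_weighted assms)

text \<open>Orthogonality to gradients is the weak form of harmonicity; the test function is the direction
  of the flux itself.\<close>

lemma flux_eq_0_AE: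
  assumes meas: "\<And>e. (\<lambda>\<omega>. G \<omega> e) \<in> borel_measurable P"
    and anti: "AE \<omega> in P. \<forall>e\<in>unit_sites. G \<omega> e = - G (translate e \<omega>) (- e)"
    and sq: "square_integrable P (\<lambda>\<omega>. edge_vec \<omega> (G \<omega>))"
    and orth: "\<And>h. h \<in> borel_measurable P \<Longrightarrow> (\<And>\<omega>. norm (h \<omega>) \<le> 1) \<Longrightarrow>
      (\<integral>\<omega>. edge_vec \<omega> (G \<omega>) \<bullet> edge_vec \<omega> (grad h \<omega>) \<partial>P) = 0"
  shows "AE \<omega> in P. flux \<omega> (G \<omega>) = 0"
proof -
  note [measurable] = measurable_flux[OF meas]
  let ?h = "\<lambda>\<omega>. flux \<omega> (G \<omega>) /\<^sub>R norm (flux \<omega> (G \<omega>))"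
  have h [measurable]: "?h \<in> borel_measurable P" by measurable
  have h1: "norm (?h \<omega>) \<le> 1" for \<omega> by (cases "flux \<omega> (G \<omega>) = 0") simp_all
  have norm_eq: "x \<bullet> (x /\<^sub>R norm x) = norm x" for x :: "real ^ 'd"
    by (cases "x = 0") (simp_all add: power2_norm_eq_inner[symmetric] power2_eq_square)
  have "(\<integral>\<omega>. norm (flux \<omega> (G \<omega>)) \<partial>P) = (\<integral>\<omega>. flux \<omega> (G \<omega>) \<bullet> ?h \<omega> \<partial>P)"
    by (simp only: norm_eq)
  also have "\<dots> = 0"
    using integral_flux_grad[OF meas anti sq h h1] orth[OF h h1] by simp
  finally have "AE \<omega> in P. norm (flux \<omega> (G \<omega>)) = 0"
    using integrable_norm[OF integrable_flux[OF meas sq]]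
    by (subst (asm) integral_nonneg_eq_0_iff_AE) auto
  then show ?thesis by simp
qed

end

section \<open>Existence and uniqueness of the corrector\<close>

definition shift_covariant :: "('d::finite conf \<Rightarrow> 'd site \<Rightarrow> real ^ 'd) \<Rightarrow> 'd conf \<Rightarrow> bool" where
  "shift_covariant X \<omega> \<longleftrightarrow> (\<forall>x y. X \<omega> x - X \<omega> y = X (translate y \<omega>) (x - y))"

lemma shift_covariantD: "shift_covariant X \<omega> \<Longrightarrow> X \<omega> (x + e) = X \<omega> x + X (translate x \<omega>) e"
  by (metis add_diff_cancel_left' diff_add_cancel add.commute shift_covariant_def)

lemma shift_covariant_anti:
  assumes "shift_covariant X \<omega>" "X \<omega> 0 = 0"
  shows "X \<omega> e = - X (translate e \<omega>) (- e)"
  using assms(1)[unfolded shift_covariant_def, rule_format, of 0 e] assms(2)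
  by (metis diff_0 minus_minus)

lemma shift_covariant_rvec_add: "shift_covariant X \<omega> \<Longrightarrow> shift_covariant (\<lambda>\<omega> x. rvec x + X \<omega> x) \<omega>"
  by (auto simp: shift_covariant_def rvec_diff algebra_simps)

lemma translate_apply_0: "translate x \<omega> (0, e) = \<omega> (x, x + e)"
  by (simp add: translate_def add.commute)

context stationary_conductances
begin

lemma measurable_countable_sites:
  "(\<And>x. (\<lambda>\<omega>. X \<omega> x) \<in> borel_measurable P) \<Longrightarrow>
   (\<lambda>(\<omega>, x). X \<omega> x) \<in> borel_measurable (P \<Otimes>\<^sub>M count_space (UNIV :: 'd site set))"
  unfolding case_prod_beta
  by (rule measurable_compose_countable'[where I = UNIV and g = snd and f = "\<lambda>x p. X (fst p) x"])
     (auto intro: measurable_compose[OF measurable_fst])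

lemma measurable_site_section:
  assumes "(\<lambda>(\<omega>, x). X \<omega> x) \<in> borel_measurable (P \<Otimes>\<^sub>M count_space (UNIV :: 'd site set))"
  shows "(\<lambda>\<omega>. X \<omega> x) \<in> borel_measurable P"
  using measurable_compose[OF measurable_Pair2' assms, of x] by simp

lemma pos_AE: "AE \<omega> in P. \<forall>x. \<forall>e\<in>unit_sites. 0 < \<omega> (x, x + e)"
proof -
  have "AE \<omega> in P. \<forall>e\<in>unit_sites. 0 < \<omega> (0, e)"
    by (rule AE_finite_allI) (auto intro: pos)
  from AE_translate_all[OF this] show ?thesis
    by eventually_elim (simp add: translate_apply_0)
qed

text \<open>For a shift-covariant function, harmonicity at \<open>x\<close> is a property of the configuration seen from
  \<open>x\<close>. By stationarity it is enough to check it at the origin.\<close>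

lemma harmonic_iff_flux:
  assumes "\<omega> \<in> nn_confs" "\<forall>x. \<forall>e\<in>unit_sites. 0 < \<omega> (x, x + e)" "shift_covariant G \<omega>"
  shows "generator \<omega> (G \<omega>) x = 0 \<longleftrightarrow> flux (translate x \<omega>) (G (translate x \<omega>)) = 0"
proof -
  have "G \<omega> (x + e) - G \<omega> x = G (translate x \<omega>) e" for e
    using shift_covariantD[OF assms(3), of x e] by simp
  then show ?thesis
    using assms(2) by (subst generator_eq_0_iff[OF assms(1)]) (auto simp: flux_def translate_apply_0)
qed

text \<open>A covariant function is determined by its increments over edges, and these are its values at the
  unit sites for the shifted configurations.\<close>

lemma eq_0_everywhere:
  assumes cov: "AE \<omega> in P. shift_covariant D \<omega>"
    and zero: "AE \<omega> in P. D \<omega> 0 = 0"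
    and edge: "AE \<omega> in P. \<forall>e\<in>unit_sites. D \<omega> e = 0"
  shows "AE \<omega> in P. \<forall>x. D \<omega> x = 0"
  using cov zero AE_translate_all[OF edge]
proof eventually_elim
  case (elim \<omega>)
  show ?case
  proof
    fix x show "D \<omega> x = 0"
    proof (induction x rule: site_induct)
      case (step x e)
      then show ?case using elim(3) shift_covariantD[OF elim(1), of x e] by simp
    qed (use elim in simp)
  qed
qed

lemma edge_vec_eq_0_iff:
  assumes "\<omega> \<in> nn_confs" "\<forall>e\<in>unit_sites. 0 < \<omega> (0, e)"
  shows "edge_vec \<omega> u = 0 \<longleftrightarrow> (\<forall>e\<in>unit_sites. u e = 0)"
proof -
  have "edge_vec \<omega> u = 0 \<longleftrightarrow> (norm (edge_vec \<omega> u))\<^sup>2 = 0" by simp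
  also have "\<dots> \<longleftrightarrow> (\<forall>e\<in>unit_sites. u e = 0)"
    unfolding edge_vec_norm[OF assms(1)] using assms(2)
    by (subst sum_nonneg_eq_0_iff) (fastforce simp: less_imp_le)+
  finally show ?thesis .
qed

lemma corrector_approx:
  assumes X: "is_corrector P X" and "0 < \<epsilon>"
  obtains h where "h \<in> borel_measurable P" "\<exists>B. \<forall>\<omega>\<in>space P. norm (h \<omega>) \<le> B"
    "square_integrable P (\<lambda>\<omega>. edge_vec \<omega> (\<lambda>x. X \<omega> x - grad h \<omega> x))"
    "(\<integral>\<omega>. (norm (edge_vec \<omega> (\<lambda>x. X \<omega> x - grad h \<omega> x)))\<^sup>2 \<partial>P) < \<epsilon>\<^sup>2"
proof -
  from X \<open>0 < \<epsilon>\<close> obtain h where h [measurable]: "h \<in> borel_measurable P" and B: "\<exists>B. \<forall>\<omega>\<in>space P. norm (h \<omega>) \<le> B"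
    and e: "energy P (\<lambda>\<omega> x. X \<omega> x - grad h \<omega> x) < ennreal (\<epsilon>\<^sup>2)"
    unfolding is_corrector_def in_gradient_closure_def by blast
  have [measurable]: "(\<lambda>\<omega>. X \<omega> x) \<in> borel_measurable P" for x
    using X by (auto simp: is_corrector_def intro: measurable_site_section)
  have sq: "square_integrable P (\<lambda>\<omega>. edge_vec \<omega> (\<lambda>x. X \<omega> x - grad h \<omega> x))"
    using order.strict_trans[OF e ennreal_less_top] by (subst square_integrable_edge_vec_iff) auto
  have "(\<integral>\<omega>. (norm (edge_vec \<omega> (\<lambda>x. X \<omega> x - grad h \<omega> x)))\<^sup>2 \<partial>P) < \<epsilon>\<^sup>2"
    using e unfolding energy_eq_integral[OF sq] by (subst (asm) ennreal_less_iff) auto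
  with h B sq show ?thesis by (rule that)
qed

text \<open>The difference \<open>D\<close> of two correctors has zero flux, so it is orthogonal to all gradients by
  integration by parts. It is also a limit of gradients, so it is orthogonal to itself.\<close>

theorem corrector_unique:
  assumes X: "is_corrector P X" and Y: "is_corrector P Y"
  shows "AE \<omega> in P. \<forall>x. Y \<omega> x = X \<omega> x"
proof -
  define D where "D \<omega> x = Y \<omega> x - X \<omega> x" for \<omega> x
  have covX: "AE \<omega> in P. shift_covariant X \<omega>" and covY: "AE \<omega> in P. shift_covariant Y \<omega>"
    using X Y by (simp_all add: is_corrector_def shift_covariant_def)
  have X0: "AE \<omega> in P. X \<omega> 0 = 0" and Y0: "AE \<omega> in P. Y \<omega> 0 = 0"
    using X Y by (auto simp: is_corrector_def)
  have measX [measurable]: "(\<lambda>\<omega>. X \<omega> x) \<in> borel_measurable P" for x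
    using X by (auto simp: is_corrector_def intro: measurable_site_section)
  have measY [measurable]: "(\<lambda>\<omega>. Y \<omega> x) \<in> borel_measurable P" for x
    using Y by (auto simp: is_corrector_def intro: measurable_site_section)
  have measD [measurable]: "(\<lambda>\<omega>. D \<omega> x) \<in> borel_measurable P" for x unfolding D_def by measurable
  have covD: "AE \<omega> in P. shift_covariant D \<omega>"
    using covX covY by eventually_elim (simp add: shift_covariant_def D_def algebra_simps)
  have D0: "AE \<omega> in P. D \<omega> 0 = 0" using X0 Y0 by eventually_elim (simp add: D_def)
  have anti: "AE \<omega> in P. \<forall>e\<in>unit_sites. D \<omega> e = - D (translate e \<omega>) (- e)"
    using covD D0 by eventually_elim (blast intro: shift_covariant_anti)
  have sqX: "square_integrable P (\<lambda>\<omega>. edge_vec \<omega> (X \<omega>))" and sqY: "square_integrable P (\<lambda>\<omega>. edge_vec \<omega> (Y \<omega>))"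
    using X Y square_integrable_edge_vec_iff[of X] square_integrable_edge_vec_iff[of Y]
    by (auto simp: is_corrector_def)
  have sqD: "square_integrable P (\<lambda>\<omega>. edge_vec \<omega> (D \<omega>))"
    using square_integrable_diff[OF sqY sqX] unfolding edge_vec_diff[symmetric] D_def .
  have fluxD: "AE \<omega> in P. flux \<omega> (D \<omega>) = 0"
  proof -
    have harmX: "AE \<omega> in P. generator \<omega> (\<lambda>z. rvec z + X \<omega> z) 0 = 0"
      and harmY: "AE \<omega> in P. generator \<omega> (\<lambda>z. rvec z + Y \<omega> z) 0 = 0"
      using X Y by (auto simp: is_corrector_def)
    from harmX harmY covX covY pos_AE AE_space show ?thesis
    proof eventually_elim
      case (elim \<omega>)
      have "flux \<omega> (\<lambda>x. rvec x + X \<omega> x) = 0" "flux \<omega> (\<lambda>x. rvec x + Y \<omega> x) = 0"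
        using elim harmonic_iff_flux[of \<omega> "\<lambda>\<omega> x. rvec x + X \<omega> x" 0]
          harmonic_iff_flux[of \<omega> "\<lambda>\<omega> x. rvec x + Y \<omega> x" 0]
        by (auto simp: space_P shift_covariant_rvec_add)
      moreover have "flux \<omega> (D \<omega>) = flux \<omega> (\<lambda>x. rvec x + Y \<omega> x) - flux \<omega> (\<lambda>x. rvec x + X \<omega> x)"
        by (simp add: flux_def D_def sum_subtractf[symmetric] algebra_simps)
      ultimately show ?case by simp
    qed
  qed
  have orth: "(\<integral>\<omega>. edge_vec \<omega> (D \<omega>) \<bullet> edge_vec \<omega> (grad h \<omega>) \<partial>P) = 0"
    if [measurable]: "h \<in> borel_measurable P" and "\<exists>B. \<forall>\<omega>\<in>space P. norm (h \<omega>) \<le> B" for h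
  proof -
    from that(2) obtain B where B: "\<And>\<omega>. \<omega> \<in> space P \<Longrightarrow> norm (h \<omega>) \<le> B" by blast
    note [measurable] = measurable_flux[OF measD]
    have "(\<integral>\<omega>. flux \<omega> (D \<omega>) \<bullet> h \<omega> \<partial>P) = (\<integral>\<omega>. 0 \<partial>P)"
      by (rule integral_cong_AE) (use fluxD in \<open>measurable, auto\<close>)
    then show ?thesis
      using integral_flux_grad[OF measD anti sqD that(1) B] by simp
  qed
  define N where "N = (\<integral>\<omega>. (norm (edge_vec \<omega> (D \<omega>)))\<^sup>2 \<partial>P)"
  have small: "N \<le> 8 * \<epsilon>\<^sup>2" if \<epsilon>: "0 < \<epsilon>" for \<epsilon> :: real
  proof -
    obtain h where h [measurable]: "h \<in> borel_measurable P" and hB: "\<exists>B. \<forall>\<omega>\<in>space P. norm (h \<omega>) \<le> B"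
      and hs: "square_integrable P (\<lambda>\<omega>. edge_vec \<omega> (\<lambda>x. X \<omega> x - grad h \<omega> x))"
      and he: "(\<integral>\<omega>. (norm (edge_vec \<omega> (\<lambda>x. X \<omega> x - grad h \<omega> x)))\<^sup>2 \<partial>P) < \<epsilon>\<^sup>2"
      using corrector_approx[OF X \<epsilon>] by blast
    obtain k where k [measurable]: "k \<in> borel_measurable P" and kB: "\<exists>B. \<forall>\<omega>\<in>space P. norm (k \<omega>) \<le> B"
      and ks: "square_integrable P (\<lambda>\<omega>. edge_vec \<omega> (\<lambda>x. Y \<omega> x - grad k \<omega> x))"
      and ke: "(\<integral>\<omega>. (norm (edge_vec \<omega> (\<lambda>x. Y \<omega> x - grad k \<omega> x)))\<^sup>2 \<partial>P) < \<epsilon>\<^sup>2"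
      using corrector_approx[OF Y \<epsilon>] by blast
    \<comment> \<open>\<open>R\<close> differs from \<open>D\<close> by a gradient, so \<open>N\<close> is the inner
      product of \<open>D\<close> and \<open>R\<close>, and \<open>R\<close> has norm at most
      \<open>2 * \<epsilon>\<close>.\<close>
    define R where "R \<omega> = edge_vec \<omega> (\<lambda>x. Y \<omega> x - grad k \<omega> x) - edge_vec \<omega> (\<lambda>x. X \<omega> x - grad h \<omega> x)" for \<omega>
    have R: "R \<omega> = edge_vec \<omega> (D \<omega>) + edge_vec \<omega> (grad h \<omega>) - edge_vec \<omega> (grad k \<omega>)" for \<omega>
      by (simp add: R_def D_def[abs_def] edge_vec_diff)
    have sR: "square_integrable P R" unfolding R_def[abs_def] by (intro square_integrable_diff ks hs)
    have sh: "square_integrable P (\<lambda>\<omega>. edge_vec \<omega> (grad h \<omega>))"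
      using square_integrable_diff[OF sqX hs] by (simp add: edge_vec_diff)
    have sk: "square_integrable P (\<lambda>\<omega>. edge_vec \<omega> (grad k \<omega>))"
      using square_integrable_diff[OF sqY ks] by (simp add: edge_vec_diff)
    have "(\<integral>\<omega>. edge_vec \<omega> (D \<omega>) \<bullet> R \<omega> \<partial>P) = N"
      unfolding R N_def power2_norm_eq_inner inner_diff_right inner_add_right
      using orth[OF h hB] orth[OF k kB] integrable_inner[OF sqD sqD] integrable_inner[OF sqD sh]
        integrable_inner[OF sqD sk] by simp
    moreover have "(\<integral>\<omega>. edge_vec \<omega> (D \<omega>) \<bullet> R \<omega> \<partial>P) \<le>
      (\<integral>\<omega>. (norm (edge_vec \<omega> (D \<omega>)))\<^sup>2 / 2 + 1 / 2 * (norm (R \<omega>))\<^sup>2 \<partial>P)"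
    proof (rule integral_mono)
      show "integrable P (\<lambda>\<omega>. edge_vec \<omega> (D \<omega>) \<bullet> R \<omega>)" by (rule integrable_inner[OF sqD sR])
      show "integrable P (\<lambda>\<omega>. (norm (edge_vec \<omega> (D \<omega>)))\<^sup>2 / 2 + 1 / 2 * (norm (R \<omega>))\<^sup>2)"
        using sqD sR by (simp add: square_integrable_def)
      show "edge_vec \<omega> (D \<omega>) \<bullet> R \<omega> \<le> (norm (edge_vec \<omega> (D \<omega>)))\<^sup>2 / 2 + 1 / 2 * (norm (R \<omega>))\<^sup>2" for \<omega>
        using abs_inner_le_AM_GM[of 1 "edge_vec \<omega> (D \<omega>)" "R \<omega>"] by simp
    qed
    moreover have "\<dots> = N / 2 + 1 / 2 * (\<integral>\<omega>. (norm (R \<omega>))\<^sup>2 \<partial>P)"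
      using sqD sR by (simp add: square_integrable_def N_def)
    moreover have "(\<integral>\<omega>. (norm (R \<omega>))\<^sup>2 \<partial>P) \<le>
      (\<integral>\<omega>. 2 * (norm (edge_vec \<omega> (\<lambda>x. Y \<omega> x - grad k \<omega> x)))\<^sup>2 +
            2 * (norm (edge_vec \<omega> (\<lambda>x. X \<omega> x - grad h \<omega> x)))\<^sup>2 \<partial>P)"
    proof (rule integral_mono)
      show "(norm (R \<omega>))\<^sup>2 \<le> 2 * (norm (edge_vec \<omega> (\<lambda>x. Y \<omega> x - grad k \<omega> x)))\<^sup>2 +
            2 * (norm (edge_vec \<omega> (\<lambda>x. X \<omega> x - grad h \<omega> x)))\<^sup>2" for \<omega>
        using norm_add_sq_le[of "edge_vec \<omega> (\<lambda>x. Y \<omega> x - grad k \<omega> x)" "- edge_vec \<omega> (\<lambda>x. X \<omega> x - grad h \<omega> x)"]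
        by (simp add: R_def)
    qed (use sR hs ks in \<open>auto simp: square_integrable_def\<close>)
    moreover have "\<dots> = 2 * (\<integral>\<omega>. (norm (edge_vec \<omega> (\<lambda>x. Y \<omega> x - grad k \<omega> x)))\<^sup>2 \<partial>P) +
            2 * (\<integral>\<omega>. (norm (edge_vec \<omega> (\<lambda>x. X \<omega> x - grad h \<omega> x)))\<^sup>2 \<partial>P)"
      using hs ks by (simp add: square_integrable_def)
    ultimately show ?thesis using he ke zero_le_power2[of \<epsilon>] by linarith
  qed
  have "N \<le> 0"
  proof (rule ccontr)
    assume "\<not> N \<le> 0"
    then have "0 < sqrt (N / 16)" by simp
    from small[OF this] \<open>\<not> N \<le> 0\<close> show False by simp
  qed
  then have "N = 0" by (simp add: N_def order_antisym)
  then have "AE \<omega> in P. (norm (edge_vec \<omega> (D \<omega>)))\<^sup>2 = 0"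
    unfolding N_def using sqD by (subst (asm) integral_nonneg_eq_0_iff_AE) (auto simp: square_integrable_def)
  from this pos_AE AE_space have "AE \<omega> in P. \<forall>e\<in>unit_sites. D \<omega> e = 0"
  proof eventually_elim
    case (elim \<omega>)
    from elim(2)[rule_format, of _ 0] elim(1,3) show ?case
      using edge_vec_eq_0_iff[of \<omega> "D \<omega>"] by (simp add: space_P)
  qed
  from eq_0_everywhere[OF covD D0 this] show ?thesis by eventually_elim (simp add: D_def)
qed

text \<open>The limit \<open>w\<close> of gradients from the projection theorem only lives on the edges at the origin.
  Gradients converge almost surely on these edges because conductances are positive, hence on all
  edges by stationarity, hence at all sites. The pointwise limit \<open>X\<close> inherits covariance from the
  gradients, and its closeness to gradients and its orthogonality from \<open>w\<close>.\<close>

theorem corrector_exists: "\<exists>X. is_corrector P X"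
proof -
  define H where "H = {h :: 'd conf \<Rightarrow> real ^ 'd. h \<in> borel_measurable P \<and> (\<exists>B. \<forall>\<omega>\<in>space P. norm (h \<omega>) \<le> B)}"
  define V where "V = (\<lambda>h \<omega>. edge_vec \<omega> (grad h \<omega>)) ` H"
  define g :: "'d conf \<Rightarrow> (real ^ 'd) ^ ('d \<times> bool)" where "g \<omega> = edge_vec \<omega> rvec" for \<omega>
  have sg: "square_integrable P g"
    unfolding g_def by (rule square_integrable_bounded[of "\<lambda>_. rvec" 1]) (auto simp: unit_sites_def)
  have sV: "square_integrable P v" if "v \<in> V" for v
  proof -
    from that obtain h B where h: "h \<in> borel_measurable P" and B: "\<And>\<omega>. \<omega> \<in> space P \<Longrightarrow> norm (h \<omega>) \<le> B"
      and v: "v = (\<lambda>\<omega>. edge_vec \<omega> (grad h \<omega>))" by (auto simp: V_def H_def)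
    have "norm (grad h \<omega> e) \<le> 2 * B" if "\<omega> \<in> space P" for \<omega> e
    proof -
      have "norm (grad h \<omega> e) \<le> norm (h (translate e \<omega>)) + norm (h \<omega>)"
        unfolding grad_def by (rule norm_triangle_ineq4)
      also have "\<dots> \<le> B + B"
        using that translate_in_nn_confs[of \<omega> e] by (intro add_mono B) (auto simp: space_P)
      finally show ?thesis by simp
    qed
    then show ?thesis unfolding v by (intro square_integrable_bounded measurable_grad h)
  qed
  have zV: "(\<lambda>x. 0) \<in> V"
  proof -
    have "(\<lambda>_. 0) \<in> H" by (auto simp: H_def)
    moreover have "(\<lambda>\<omega> :: 'd conf. edge_vec \<omega> (grad (\<lambda>_. 0) \<omega>)) = (\<lambda>x. 0)"
      by (simp add: fun_eq_iff grad_def edge_vec_def vec_eq_iff)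
    ultimately show ?thesis unfolding V_def by (intro image_eqI[where x = "\<lambda>_. 0"]) auto
  qed
  have cV: "(\<lambda>x. u x + c *\<^sub>R v x) \<in> V" if "u \<in> V" "v \<in> V" for u v c
  proof -
    from that obtain h k where hk: "h \<in> H" "k \<in> H"
      and u: "u = (\<lambda>\<omega>. edge_vec \<omega> (grad h \<omega>))" and v: "v = (\<lambda>\<omega>. edge_vec \<omega> (grad k \<omega>))"
      by (auto simp: V_def)
    from hk obtain B B' where [measurable]: "h \<in> borel_measurable P" "k \<in> borel_measurable P"
      and B: "\<And>\<omega>. \<omega> \<in> space P \<Longrightarrow> norm (h \<omega>) \<le> B" "\<And>\<omega>. \<omega> \<in> space P \<Longrightarrow> norm (k \<omega>) \<le> B'"
      by (auto simp: H_def)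
    let ?l = "\<lambda>\<omega>. h \<omega> + c *\<^sub>R k \<omega>"
    have "norm (?l \<omega>) \<le> B + \<bar>c\<bar> * B'" if "\<omega> \<in> space P" for \<omega>
      using B(1)[OF that] mult_left_mono[OF B(2)[OF that], of "\<bar>c\<bar>"] norm_triangle_ineq[of "h \<omega>" "c *\<^sub>R k \<omega>"]
      by simp
    then have "?l \<in> H" unfolding H_def by auto
    moreover have "(\<lambda>x. u x + c *\<^sub>R v x) = (\<lambda>\<omega>. edge_vec \<omega> (grad ?l \<omega>))"
    proof
      fix \<omega>
      have "grad ?l \<omega> = (\<lambda>e. grad h \<omega> e + c *\<^sub>R grad k \<omega> e)"
        by (simp add: fun_eq_iff grad_def algebra_simps)
      then show "u \<omega> + c *\<^sub>R v \<omega> = edge_vec \<omega> (grad ?l \<omega>)" by (simp add: u v edge_vec_linear)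
    qed
    ultimately show ?thesis unfolding V_def by blast
  qed
  obtain v w where v: "\<And>n. v n \<in> V" and sw: "square_integrable P w"
    and vw: "AE \<omega> in P. (\<lambda>n. v n \<omega>) \<longlonglongrightarrow> w \<omega>"
    and vw2: "(\<lambda>n. \<integral>\<omega>. (norm (w \<omega> - v n \<omega>))\<^sup>2 \<partial>P) \<longlonglongrightarrow> 0"
    and orth: "\<And>u. u \<in> V \<Longrightarrow> (\<integral>\<omega>. (g \<omega> + w \<omega>) \<bullet> u \<omega> \<partial>P) = 0"
    using L2_projection[of V P g, OF sV sg zV cV] by blast
  have "\<forall>n. \<exists>h\<in>H. v n = (\<lambda>\<omega>. edge_vec \<omega> (grad h \<omega>))" using v by (auto simp: V_def)
  then obtain h where h: "\<And>n. h n \<in> H" and vh: "\<And>n. v n = (\<lambda>\<omega>. edge_vec \<omega> (grad (h n) \<omega>))" by metis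
  have hm [measurable]: "h n \<in> borel_measurable P" for n using h by (auto simp: H_def)
  have conv_e: "AE \<omega> in P. \<forall>e\<in>unit_sites. convergent (\<lambda>n. grad (h n) \<omega> e)"
    using vw pos_AE
  proof eventually_elim
    case (elim \<omega>)
    show ?case
    proof
      fix e :: "'d site" assume e: "e \<in> unit_sites"
      then obtain j where j: "e = unit_site j" by (rule unit_sitesE)
      let ?s = "sqrt (\<omega> (0, e))"
      have s: "?s \<noteq> 0" using elim(2)[rule_format, of e 0] e by simp
      have "(\<lambda>n. v n \<omega> $ j) \<longlonglongrightarrow> w \<omega> $ j" using elim(1) by (rule tendsto_vec_nth)
      then have "(\<lambda>n. ?s *\<^sub>R grad (h n) \<omega> e) \<longlonglongrightarrow> w \<omega> $ j"
        by (simp add: vh edge_vec_def j)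
      then have "(\<lambda>n. inverse ?s *\<^sub>R (?s *\<^sub>R grad (h n) \<omega> e)) \<longlonglongrightarrow> inverse ?s *\<^sub>R (w \<omega> $ j)"
        by (intro tendsto_scaleR tendsto_const)
      then have "(\<lambda>n. grad (h n) \<omega> e) \<longlonglongrightarrow> inverse ?s *\<^sub>R (w \<omega> $ j)" using s by simp
      then show "convergent (\<lambda>n. grad (h n) \<omega> e)" by (auto simp: convergent_def)
    qed
  qed
  have conv: "AE \<omega> in P. \<forall>x. convergent (\<lambda>n. grad (h n) \<omega> x)"
    using AE_translate_all[OF conv_e]
  proof eventually_elim
    case (elim \<omega>)
    show ?case
    proof
      fix x show "convergent (\<lambda>n. grad (h n) \<omega> x)"
      proof (induction x rule: site_induct)
        case zero then show ?case by (simp add: grad_def convergent_const)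
      next
        case (step x e)
        then show ?case unfolding grad_cocycle using elim by (intro convergent_add) auto
      qed
    qed
  qed
  define X where "X \<omega> x = lim (\<lambda>n. grad (h n) \<omega> x)" for \<omega> x
  have X_lim: "(\<lambda>n. grad (h n) \<omega> x) \<longlonglongrightarrow> X \<omega> x" if "convergent (\<lambda>n. grad (h n) \<omega> x)" for \<omega> x
    using that by (simp add: X_def convergent_LIMSEQ_iff)
  have Xm [measurable]: "(\<lambda>\<omega>. X \<omega> x) \<in> borel_measurable P" for x unfolding X_def by measurable
  have X0: "X \<omega> 0 = 0" for \<omega>
    by (simp add: X_def grad_def limI[OF tendsto_const])
  have covX: "AE \<omega> in P. shift_covariant X \<omega>"
    using conv
  proof eventually_elim
    case (elim \<omega>)
    show ?case unfolding shift_covariant_def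
    proof (intro allI)
      fix x y
      have eq: "grad k \<omega> x - grad k \<omega> y = grad k (translate y \<omega>) (x - y)" for k :: "'d conf \<Rightarrow> real ^ 'd"
        using grad_cocycle[of k \<omega> y "x - y"] by simp
      have lim: "(\<lambda>n. grad (h n) \<omega> x - grad (h n) \<omega> y) \<longlonglongrightarrow> X \<omega> x - X \<omega> y"
        using elim by (intro tendsto_diff X_lim) auto
      then have "convergent (\<lambda>n. grad (h n) (translate y \<omega>) (x - y))"
        unfolding eq by (auto simp: convergent_def)
      from LIMSEQ_unique[OF lim[unfolded eq] X_lim[OF this]]
      show "X \<omega> x - X \<omega> y = X (translate y \<omega>) (x - y)" .
    qed
  qed
  have wX: "AE \<omega> in P. w \<omega> = edge_vec \<omega> (X \<omega>)"
    using vw conv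
  proof eventually_elim
    case (elim \<omega>)
    have "(\<lambda>n. v n \<omega>) \<longlonglongrightarrow> edge_vec \<omega> (X \<omega>)"
      unfolding vh edge_vec_def using elim(2) by (intro tendsto_vec_lambda tendsto_scaleR tendsto_const X_lim) auto
    with elim(1) show ?case by (rule LIMSEQ_unique)
  qed
  have mX: "(\<lambda>\<omega>. edge_vec \<omega> (X \<omega>)) \<in> borel_measurable P" by (rule measurable_edge_vec[OF Xm])
  have [measurable]: "w \<in> borel_measurable P" using sw by (simp add: square_integrable_def)
  have sX: "square_integrable P (\<lambda>\<omega>. edge_vec \<omega> (X \<omega>))"
    unfolding square_integrable_def
  proof
    have "AE \<omega> in P. (norm (w \<omega>))\<^sup>2 = (norm (edge_vec \<omega> (X \<omega>)))\<^sup>2" using wX by eventually_elim simp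
    then show "integrable P (\<lambda>\<omega>. (norm (edge_vec \<omega> (X \<omega>)))\<^sup>2)"
      using sw mX by (subst integrable_cong_AE[symmetric, where f = "\<lambda>\<omega>. (norm (w \<omega>))\<^sup>2"])
        (auto simp: square_integrable_def)
  qed (rule mX)
  have closure: "in_gradient_closure P X"
    unfolding in_gradient_closure_def
  proof (intro allI impI)
    fix \<epsilon> :: real assume "0 < \<epsilon>"
    then have "0 < \<epsilon>\<^sup>2" by simp
    from order_tendstoD(2)[OF vw2 this] obtain n where n: "(\<integral>\<omega>. (norm (w \<omega> - v n \<omega>))\<^sup>2 \<partial>P) < \<epsilon>\<^sup>2"
      by (auto simp: eventually_sequentially)
    have sd: "square_integrable P (\<lambda>\<omega>. edge_vec \<omega> (\<lambda>x. X \<omega> x - grad (h n) \<omega> x))"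
      unfolding edge_vec_diff using square_integrable_diff[OF sX sV[OF v[of n]]] by (simp add: vh)
    have "(\<integral>\<omega>. (norm (edge_vec \<omega> (\<lambda>x. X \<omega> x - grad (h n) \<omega> x)))\<^sup>2 \<partial>P) = (\<integral>\<omega>. (norm (w \<omega> - v n \<omega>))\<^sup>2 \<partial>P)"
    proof (rule integral_cong_AE)
      show "AE \<omega> in P. (norm (edge_vec \<omega> (\<lambda>x. X \<omega> x - grad (h n) \<omega> x)))\<^sup>2 = (norm (w \<omega> - v n \<omega>))\<^sup>2"
        using wX by eventually_elim (simp add: edge_vec_diff vh)
    qed (use sd sw sV[OF v[of n]] in \<open>auto simp: square_integrable_def\<close>)
    with n have "energy P (\<lambda>\<omega> x. X \<omega> x - grad (h n) \<omega> x) < ennreal (\<epsilon>\<^sup>2)"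
      unfolding energy_eq_integral[OF sd] by (subst ennreal_less_iff) auto
    with h[of n] show "\<exists>h. h \<in> borel_measurable P \<and> (\<exists>B. \<forall>\<omega>\<in>space P. norm (h \<omega>) \<le> B) \<and>
        energy P (\<lambda>\<omega> x. X \<omega> x - grad h \<omega> x) < ennreal (\<epsilon>\<^sup>2)"
      unfolding H_def by blast
  qed
  define G where "G \<omega> x = rvec x + X \<omega> x" for \<omega> x
  have Gm [measurable]: "(\<lambda>\<omega>. G \<omega> x) \<in> borel_measurable P" for x unfolding G_def by measurable
  have covG: "AE \<omega> in P. shift_covariant G \<omega>"
    using covX unfolding G_def[abs_def] by eventually_elim (rule shift_covariant_rvec_add)
  have Gg: "edge_vec \<omega> (G \<omega>) = g \<omega> + edge_vec \<omega> (X \<omega>)" for \<omega>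
    unfolding G_def[abs_def] g_def by (rule edge_vec_add)
  have sG: "square_integrable P (\<lambda>\<omega>. edge_vec \<omega> (G \<omega>))"
    unfolding Gg by (intro square_integrable_add sg sX)
  have flux: "AE \<omega> in P. flux \<omega> (G \<omega>) = 0"
  proof (rule flux_eq_0_AE[OF Gm _ sG])
    show "AE \<omega> in P. \<forall>e\<in>unit_sites. G \<omega> e = - G (translate e \<omega>) (- e)"
    proof (use covG in eventually_elim)
      case (elim \<omega>)
      have "G \<omega> 0 = 0" by (simp add: G_def X0)
      from shift_covariant_anti[OF elim this] show ?case by blast
    qed
    fix k :: "'d conf \<Rightarrow> real ^ 'd" assume k [measurable]: "k \<in> borel_measurable P" and k1: "\<And>\<omega>. norm (k \<omega>) \<le> 1"
    then have "k \<in> H" by (auto simp: H_def)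
    then have kV: "(\<lambda>\<omega>. edge_vec \<omega> (grad k \<omega>)) \<in> V" by (simp add: V_def)
    have "(\<integral>\<omega>. edge_vec \<omega> (G \<omega>) \<bullet> edge_vec \<omega> (grad k \<omega>) \<partial>P) = (\<integral>\<omega>. (g \<omega> + w \<omega>) \<bullet> edge_vec \<omega> (grad k \<omega>) \<partial>P)"
    proof (rule integral_cong_AE)
      show "AE \<omega> in P. edge_vec \<omega> (G \<omega>) \<bullet> edge_vec \<omega> (grad k \<omega>) = (g \<omega> + w \<omega>) \<bullet> edge_vec \<omega> (grad k \<omega>)"
        using wX by eventually_elim (simp add: Gg)
    qed (use sG sg sw sV[OF kV] in \<open>auto simp: square_integrable_def\<close>)
    then show "(\<integral>\<omega>. edge_vec \<omega> (G \<omega>) \<bullet> edge_vec \<omega> (grad k \<omega>) \<partial>P) = 0" by (simp add: orth[OF kV])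
  qed
  have harm: "AE \<omega> in P. \<forall>x. generator \<omega> (\<lambda>z. rvec z + X \<omega> z) x = 0"
    using AE_translate_all[OF flux] covG pos_AE AE_space
  proof eventually_elim
    case (elim \<omega>)
    then show ?case using harmonic_iff_flux[of \<omega> G] by (simp add: space_P G_def[abs_def])
  qed
  have "is_corrector P X"
    unfolding is_corrector_def
  proof (intro conjI)
    show "(\<lambda>(\<omega>, x). X \<omega> x) \<in> borel_measurable (P \<Otimes>\<^sub>M count_space UNIV)"
      by (rule measurable_countable_sites[OF Xm])
    show "AE \<omega> in P. \<forall>x y. X \<omega> x - X \<omega> y = X (translate y \<omega>) (x - y)"
      using covX by (simp add: shift_covariant_def)
    show "energy P X < \<infinity>" using sX square_integrable_edge_vec_iff[OF Xm] by simp
  qed (use X0 harm closure in auto)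
  then show ?thesis by blast
qed

end

theorem (in stationary_conductances) corrector_well_definedI:
  assumes "\<And>e. e \<in> unit_sites \<Longrightarrow> integrable P (\<lambda>\<omega>. 1 / \<omega> (0, e))"
  shows "corrector_well_defined P"
  unfolding corrector_well_defined_def
proof (intro conjI allI impI)
  have "square_integrable P (\<lambda>\<omega>. edge_vec \<omega> rvec)"
    by (rule square_integrable_bounded[of "\<lambda>_. rvec" 1]) (auto simp: unit_sites_def)
  then show "energy P (\<lambda>\<omega>. rvec) < \<infinity>"
    using square_integrable_edge_vec_iff[of "\<lambda>_. rvec"] by simp
  fix e :: "'d site" assume "norm (rvec e) = 1"
  then have e: "e \<in> unit_sites" by (simp add: unit_sites_def)
  have "(\<integral>\<^sup>+ \<omega>. 1 / ennreal (\<omega> (0, e)) \<partial>P) = (\<integral>\<^sup>+ \<omega>. ennreal (norm (1 / \<omega> (0, e))) \<partial>P)"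
  proof (rule nn_integral_cong_AE, use pos[OF e] in eventually_elim)
    case (elim \<omega>)
    then show ?case using divide_ennreal[of 1 "\<omega> (0, e)"] by simp
  qed
  also have "\<dots> < \<infinity>" using assms[OF e] by (simp add: integrable_iff_bounded)
  finally show "(\<integral>\<^sup>+ \<omega>. 1 / ennreal (\<omega> (0, e)) \<partial>P) < \<infinity>" .
next
  obtain X where "is_corrector P X" using corrector_exists by blast
  then show "\<exists>X. is_corrector P X \<and> (\<forall>Y. is_corrector P Y \<longrightarrow> (AE \<omega> in P. \<forall>x. Y \<omega> x = X \<omega> x))"
    using corrector_unique by blast
qed

section \<open>The odometer\<close>

text \<open>A point of the \<open>d\<close>-fold product of the 2-adic integers is given by its residues \<open>r k\<close> modulo
  \<open>2 ^ k\<close>, which are compatible with each other. All functions below are defined on arbitrary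
  sequences of sites, and the law is supported by the compatible ones.\<close>

definition reduce :: "nat \<Rightarrow> 'd::finite site \<Rightarrow> 'd site" where
  "reduce k a = (\<chi> i. a $ i mod 2 ^ k)"

definition residue_box :: "nat \<Rightarrow> 'd::finite site set" where
  "residue_box k = {a. reduce k a = a}"

definition compatible :: "(nat \<Rightarrow> 'd::finite site) \<Rightarrow> bool" where
  "compatible r \<longleftrightarrow> (\<forall>k. \<forall>j\<le>k. r j = reduce j (r k))"

definition rotate_residues :: "'d::finite site \<Rightarrow> (nat \<Rightarrow> 'd site) \<Rightarrow> nat \<Rightarrow> 'd site" where
  "rotate_residues z r = (\<lambda>k. reduce k (r k + z))"

definition residue_space :: "(nat \<Rightarrow> 'd::finite site) measure" where
  "residue_space = PiM UNIV (\<lambda>_. count_space UNIV)"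

text \<open>Independent uniform binary digits give a uniformly distributed 2-adic integer.\<close>

definition digit_residues :: "(nat \<Rightarrow> 'd::finite \<Rightarrow> bool) \<Rightarrow> nat \<Rightarrow> 'd site" where
  "digit_residues s k = (\<chi> i. horner_sum of_bool 2 (map (\<lambda>j. s j i) [0..<k]))"

definition digit_space :: "(nat \<Rightarrow> 'd::finite \<Rightarrow> bool) measure" where
  "digit_space = PiM UNIV (\<lambda>_. measure_pmf (pmf_of_set UNIV))"

definition odometer :: "(nat \<Rightarrow> 'd::finite site) measure" where
  "odometer = distr digit_space residue_space digit_residues"

lemma reduce_nth [simp]: "reduce k a $ i = a $ i mod 2 ^ k"
  by (simp add: reduce_def)

lemma mod_power2_mod_power2: "j \<le> k \<Longrightarrow> (a :: int) mod 2 ^ k mod 2 ^ j = a mod 2 ^ j"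
  by (rule mod_mod_cancel[OF le_imp_power_dvd])

lemma reduce_reduce: "j \<le> k \<Longrightarrow> reduce j (reduce k a) = reduce j a"
  by (simp add: vec_eq_iff mod_power2_mod_power2)

lemma reduce_add_left: "j \<le> k \<Longrightarrow> reduce j (reduce k a + b) = reduce j (a + b)"
  by (simp add: vec_eq_iff mod_add_cong[OF mod_power2_mod_power2 refl])

lemma reduce_in_box: "reduce k a \<in> residue_box k"
  by (simp add: residue_box_def reduce_reduce)

lemma residue_box_nth:
  assumes "a \<in> residue_box k"
  shows "a $ i mod 2 ^ k = a $ i"
proof -
  have "reduce k a = a" using assms by (simp add: residue_box_def)
  from arg_cong[OF this, of "\<lambda>v. v $ i"] show ?thesis by simp
qed

lemma residue_boxD:
  assumes "a \<in> residue_box k"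
  shows "0 \<le> a $ i" "a $ i < 2 ^ k"
  using pos_mod_sign[of "2 ^ k" "a $ i"] pos_mod_bound[of "2 ^ k" "a $ i"]
  by (simp_all add: residue_box_nth[OF assms])

lemma finite_residue_box [simp]: "finite (residue_box k :: 'd::finite site set)"
  by (rule finite_subset[OF _ finite_site_box[of "{0..<2 ^ k}"]]) (simp_all add: subset_iff residue_boxD)

lemma compatibleD: "compatible r \<Longrightarrow> j \<le> k \<Longrightarrow> r j = reduce j (r k)"
  by (simp add: compatible_def)

lemma compatible_box: "compatible r \<Longrightarrow> r k \<in> residue_box k"
  using compatibleD[of r k k] by (simp add: residue_box_def)

lemma compatible_rotate_residues:
  assumes "compatible r"
  shows "compatible (rotate_residues z r)"
  unfolding compatible_def
proof (intro allI impI)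
  fix k j :: nat assume jk: "j \<le> k"
  have "rotate_residues z r j = reduce j (reduce j (r k) + z)"
    by (simp only: rotate_residues_def flip: compatibleD[OF assms jk])
  also have "\<dots> = reduce j (rotate_residues z r k)"
    unfolding rotate_residues_def using jk by (simp only: reduce_reduce reduce_add_left order_refl)
  finally show "rotate_residues z r j = reduce j (rotate_residues z r k)" .
qed

lemma compatible_digit_residues: "compatible (digit_residues s)"
  unfolding compatible_def
proof (intro allI impI)
  fix k j :: nat assume jk: "j \<le> k"
  have "digit_residues s k $ i mod 2 ^ j = digit_residues s j $ i" for i
  proof -
    have "digit_residues s k $ i mod 2 ^ j = take_bit j (digit_residues s k $ i)"
      by (simp only: take_bit_eq_mod)
    also have "\<dots> = horner_sum of_bool 2 (take j (map (\<lambda>j. s j i) [0..<k]))"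
      by (simp only: digit_residues_def vec_lambda_beta take_bit_horner_sum_bit_eq)
    also have "\<dots> = digit_residues s j $ i"
      using jk by (simp add: digit_residues_def take_map)
    finally show ?thesis .
  qed
  then show "digit_residues s j = reduce j (digit_residues s k)"
    by (simp only: vec_eq_iff reduce_nth simp_thms)
qed

lemma digit_residues_eq_iff:
  assumes "a \<in> residue_box k"
  shows "digit_residues s k = a \<longleftrightarrow> (\<forall>j\<in>{..<k}. s j \<in> {\<lambda>i. bit (a $ i) j})"
proof
  assume "digit_residues s k = a"
  then have eq: "a $ i = horner_sum of_bool 2 (map (\<lambda>j. s j i) [0..<k])" for i
    by (simp add: digit_residues_def vec_eq_iff)
  have "bit (a $ i) j \<longleftrightarrow> s j i" if "j < k" for i j
    using that unfolding eq bit_horner_sum_bit_iff by simp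
  then show "\<forall>j\<in>{..<k}. s j \<in> {\<lambda>i. bit (a $ i) j}" by auto
next
  assume *: "\<forall>j\<in>{..<k}. s j \<in> {\<lambda>i. bit (a $ i) j}"
  have "horner_sum of_bool 2 (map (\<lambda>j. s j i) [0..<k]) = a $ i" for i
  proof -
    have "map (\<lambda>j. s j i) [0..<k] = map (bit (a $ i)) [0..<k]" using * by auto
    then have "horner_sum of_bool 2 (map (\<lambda>j. s j i) [0..<k]) = take_bit k (a $ i)"
      by (simp only: horner_sum_bit_eq_take_bit)
    also have "\<dots> = a $ i"
      unfolding take_bit_eq_mod by (rule residue_box_nth[OF assms])
    finally show ?thesis .
  qed
  then show "digit_residues s k = a" by (simp add: digit_residues_def vec_eq_iff)
qed

lemma space_residue_space [simp]: "space residue_space = UNIV"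
  by (simp add: residue_space_def space_PiM)

lemma measurable_residue [measurable]: "(\<lambda>r. r k) \<in> residue_space \<rightarrow>\<^sub>M count_space UNIV"
  unfolding residue_space_def by (rule measurable_component_singleton) simp

lemma sets_residue_Collect: "Measurable.pred residue_space Q \<Longrightarrow> {r. Q r} \<in> sets residue_space"
  by (simp add: pred_def)

lemma sets_residue_eq: "{r. r k = a} \<in> sets residue_space"
  by (rule sets_residue_Collect) measurable

lemma sets_compatible: "{r. compatible r} \<in> sets residue_space"
  unfolding compatible_def by (rule sets_residue_Collect) measurable

lemma measurable_into_residue_space:
  "(\<And>k. (\<lambda>s. f s k) \<in> M \<rightarrow>\<^sub>M count_space UNIV) \<Longrightarrow> f \<in> M \<rightarrow>\<^sub>M residue_space"
  unfolding residue_space_def by (rule measurable_PiM_single') auto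

lemma space_digit_space [simp]: "space digit_space = UNIV"
  by (simp add: digit_space_def space_PiM)

lemma measurable_digit [measurable]: "(\<lambda>s :: nat \<Rightarrow> 'd::finite \<Rightarrow> bool. s j) \<in> digit_space \<rightarrow>\<^sub>M count_space UNIV"
proof -
  have "(\<lambda>s :: nat \<Rightarrow> 'd \<Rightarrow> bool. s j) \<in> digit_space \<rightarrow>\<^sub>M measure_pmf (pmf_of_set (UNIV :: ('d \<Rightarrow> bool) set))"
    unfolding digit_space_def by (rule measurable_component_singleton) simp
  then show ?thesis by (simp cong: measurable_cong_sets)
qed

lemma measurable_digit_residues [measurable]: "(digit_residues :: (nat \<Rightarrow> 'd::finite \<Rightarrow> bool) \<Rightarrow> _) \<in> digit_space \<rightarrow>\<^sub>M residue_space"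
proof (rule measurable_into_residue_space)
  fix k
  show "(\<lambda>s :: nat \<Rightarrow> 'd \<Rightarrow> bool. digit_residues s k) \<in> digit_space \<rightarrow>\<^sub>M count_space UNIV"
  proof (induction k)
    case 0 then show ?case by (simp add: digit_residues_def)
  next
    case (Suc k)
    have "digit_residues s (Suc k) = digit_residues s k + (\<chi> i. of_bool (s k i) * 2 ^ k)" for s :: "nat \<Rightarrow> 'd \<Rightarrow> bool"
      by (simp add: digit_residues_def vec_eq_iff horner_sum_append)
    moreover have "(\<lambda>s :: nat \<Rightarrow> 'd \<Rightarrow> bool. digit_residues s k + (\<chi> i. of_bool (s k i) * 2 ^ k)) \<in> digit_space \<rightarrow>\<^sub>M count_space UNIV"
    proof (rule measurable_compose_countable[where g = "\<lambda>s. digit_residues s k"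
          and f = "\<lambda>x s. x + (\<chi> i. of_bool (s k i) * 2 ^ k)", OF _ Suc.IH])
      show "(\<lambda>s :: nat \<Rightarrow> 'd \<Rightarrow> bool. x + (\<chi> i. of_bool (s k i) * 2 ^ k)) \<in> digit_space \<rightarrow>\<^sub>M count_space UNIV" for x :: "'d site"
        using measurable_compose[OF measurable_digit[of k], where g = "\<lambda>b. x + (\<chi> i. of_bool (b i) * 2 ^ k)"]
        by simp
    qed
    ultimately show ?case by simp
  qed
qed

lemma prob_space_digit_space: "prob_space digit_space"
  unfolding digit_space_def by (intro prob_space_PiM measure_pmf.prob_space_axioms)

lemma prob_space_odometer: "prob_space odometer"
  unfolding odometer_def by (intro prob_space.prob_space_distr prob_space_digit_space measurable_digit_residues)

lemma sets_odometer [measurable_cong, simp]: "sets odometer = sets residue_space"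
  by (simp add: odometer_def)

lemma space_odometer [simp]: "space odometer = UNIV"
  by (simp add: odometer_def)

lemma AE_compatible: "AE r in odometer. compatible (r :: nat \<Rightarrow> 'd::finite site)"
proof -
  have "(AE r in odometer. compatible (r :: nat \<Rightarrow> 'd site)) \<longleftrightarrow>
      (AE s in digit_space. compatible (digit_residues s :: nat \<Rightarrow> 'd site))"
    unfolding odometer_def using sets_compatible
    by (intro AE_distr_iff[OF measurable_digit_residues]) simp
  then show ?thesis by (simp add: compatible_digit_residues)
qed

lemma emeasure_odometer_residue:
  assumes "a \<in> residue_box k"
  shows "emeasure odometer {r. r k = (a :: 'd::finite site)} = ennreal ((1 / 2 ^ CARD('d)) ^ k)"
proof -
  interpret product_prob_space "\<lambda>_. measure_pmf (pmf_of_set (UNIV :: ('d \<Rightarrow> bool) set))" "UNIV :: nat set"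
    by unfold_locales
  have "emeasure odometer {r. r k = a} = emeasure digit_space {s. digit_residues s k = a}"
    unfolding odometer_def
    by (subst emeasure_distr[OF measurable_digit_residues sets_residue_eq]) (simp add: vimage_def)
  also have "{s. digit_residues s k = a} = {s \<in> space digit_space. \<forall>j\<in>{..<k}. s j \<in> {\<lambda>i. bit (a $ i) j}}"
    by (simp only: digit_residues_eq_iff[OF assms] space_digit_space UNIV_I simp_thms)
  also have "emeasure digit_space \<dots> =
      (\<Prod>j\<in>{..<k}. emeasure (measure_pmf (pmf_of_set UNIV)) {\<lambda>i. bit (a $ i) j})"
    unfolding digit_space_def by (rule emeasure_PiM_Collect) simp_all
  also have "\<dots> = ennreal ((1 / 2 ^ CARD('d)) ^ k)"
    by (simp add: emeasure_pmf_single pmf_of_set card_fun ennreal_power power_divide)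
  finally show ?thesis .
qed

text \<open>For compatible sequences an event about finitely many residues is an event about the last of
  them. So the events \<open>r k = a\<close> determine the measure.\<close>

lemma residue_measure_eqI:
  fixes M N :: "(nat \<Rightarrow> 'd::finite site) measure"
  assumes [measurable_cong]: "sets M = sets residue_space" "sets N = sets residue_space"
    and fin: "finite_measure M"
    and compat: "AE r in M. compatible r" "AE r in N. compatible r"
    and eq: "\<And>k a. a \<in> residue_box k \<Longrightarrow> emeasure M {r. r k = a} = emeasure N {r. r k = a}"
  shows "M = N"
proof (rule measure_eqI_PiM_infinite[where I = UNIV and M = "\<lambda>_. count_space UNIV"])
  show "sets M = sets (PiM UNIV (\<lambda>_. count_space UNIV))" "sets N = sets (PiM UNIV (\<lambda>_. count_space UNIV))"
    using assms(1,2) by (simp_all add: residue_space_def)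
  fix A :: "nat \<Rightarrow> 'd site set" and J :: "nat set" assume "finite J"
  then obtain k where k: "\<And>j. j \<in> J \<Longrightarrow> j \<le> k" by (meson finite_nat_set_iff_bounded_le)
  \<comment> \<open>All residues with index in \<open>J\<close> are determined by the residue modulo
    \<open>2 ^ k\<close>.\<close>
  define B where "B = {a \<in> residue_box k. \<forall>j\<in>J. reduce j a \<in> A j}"
  define C where "C = prod_emb UNIV (\<lambda>_. count_space UNIV) J (Pi\<^sub>E J A)"
  have fB: "finite B" by (simp add: B_def)
  have iff: "r \<in> C \<longleftrightarrow> r k \<in> B" if "compatible r" for r
  proof -
    have "r \<in> C \<longleftrightarrow> (\<forall>j\<in>J. r j \<in> A j)" by (auto simp: C_def prod_emb_def PiE_iff)
    also have "\<dots> \<longleftrightarrow> r k \<in> B"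
    proof -
      have "r j = reduce j (r k)" if "j \<in> J" for j
        using compatibleD[OF \<open>compatible r\<close> k[OF that]] .
      then show ?thesis using compatible_box[OF \<open>compatible r\<close>, of k] by (simp add: B_def)
    qed
    finally show ?thesis .
  qed
  have C: "C \<in> sets residue_space"
    unfolding C_def residue_space_def by (intro sets_PiM_I \<open>finite J\<close>) auto
  have meas: "{r. r k \<in> B} \<in> sets residue_space"
    by (rule sets_residue_Collect) measurable
  have cyl: "emeasure L C = (\<Sum>a\<in>B. emeasure L {r. r k = a})"
    if L [measurable_cong]: "sets L = sets residue_space" and AE: "AE r in L. compatible r" for L
  proof -
    have "emeasure L C = emeasure L {r. r k \<in> B}"
      using AE by (intro emeasure_eq_AE) (auto simp: L C meas elim!: eventually_mono simp: iff)
    also have "{r. r k \<in> B} = (\<Union>a\<in>B. {r. r k = a})" by auto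
    also have "emeasure L \<dots> = (\<Sum>a\<in>B. emeasure L {r. r k = a})"
      by (rule sum_emeasure[symmetric]) (auto simp: fB disjoint_family_on_def L sets_residue_eq)
    finally show ?thesis .
  qed
  have "(\<Sum>a\<in>B. emeasure M {r. r k = a}) = (\<Sum>a\<in>B. emeasure N {r. r k = a})"
    by (intro sum.cong eq) (auto simp: B_def)
  then show "emeasure M C = emeasure N C" using assms by (simp add: cyl)
qed (rule fin)

lemma measurable_rotate_residues [measurable]: "rotate_residues z \<in> residue_space \<rightarrow>\<^sub>M residue_space"
proof (rule measurable_into_residue_space)
  show "(\<lambda>r. rotate_residues z r k) \<in> residue_space \<rightarrow>\<^sub>M count_space UNIV" for k
    unfolding rotate_residues_def by measurable
qed

lemma rotate_residues_eq_iff: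
  assumes "compatible r" "a \<in> residue_box k"
  shows "rotate_residues z r k = a \<longleftrightarrow> r k = reduce k (a - z)"
proof
  assume "rotate_residues z r k = a"
  then have "reduce k (a - z) = reduce k (reduce k (r k + z) + (- z))"
    by (auto simp: rotate_residues_def)
  also have "\<dots> = reduce k (r k)" by (subst reduce_add_left) simp_all
  also have "\<dots> = r k" using compatible_box[OF assms(1)] by (simp add: residue_box_def)
  finally show "r k = reduce k (a - z)" by simp
next
  assume "r k = reduce k (a - z)"
  then have "rotate_residues z r k = reduce k (a - z + z)" by (simp only: rotate_residues_def reduce_add_left[OF order_refl])
  then show "rotate_residues z r k = a" using assms(2) by (simp add: residue_box_def)
qed

lemma distr_rotate_residues: "distr odometer odometer (rotate_residues (z :: 'd::finite site)) = odometer"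
proof (rule residue_measure_eqI)
  interpret prob_space "odometer :: (nat \<Rightarrow> 'd site) measure" by (rule prob_space_odometer)
  show "finite_measure (distr odometer odometer (rotate_residues z))"
    by (intro prob_space.finite_measure prob_space_distr) measurable
  have "(AE r in distr odometer odometer (rotate_residues z). compatible r) \<longleftrightarrow>
      (AE r in odometer. compatible (rotate_residues z r))"
    using sets_compatible by (intro AE_distr_iff) simp_all
  then show "AE r in distr odometer odometer (rotate_residues z). compatible r"
    using AE_compatible by (auto elim!: eventually_mono intro: compatible_rotate_residues)
  fix k and a :: "'d site" assume a: "a \<in> residue_box k"
  have "emeasure (distr odometer odometer (rotate_residues z)) {r. r k = a} = emeasure odometer {r. rotate_residues z r k = a}"
    by (subst emeasure_distr) (simp_all add: sets_residue_eq vimage_def)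
  also have "\<dots> = emeasure odometer {r. r k = reduce k (a - z)}"
  proof (intro emeasure_eq_AE)
    show "AE r in odometer. r \<in> {r. rotate_residues z r k = a} \<longleftrightarrow> r \<in> {r. r k = reduce k (a - z)}"
      using AE_compatible by eventually_elim (simp add: rotate_residues_eq_iff[OF _ a])
    show "{r. rotate_residues z r k = a} \<in> sets odometer"
      unfolding sets_odometer rotate_residues_def by (rule sets_residue_Collect) measurable
  qed (simp add: sets_residue_eq)
  also have "\<dots> = emeasure odometer {r. r k = a}"
    using a by (simp add: emeasure_odometer_residue reduce_in_box)
  finally show "emeasure (distr odometer odometer (rotate_residues z)) {r. r k = a} = emeasure odometer {r. r k = a}" .
qed (auto simp: AE_compatible)

text \<open>For each \<open>k\<close> rotations permute the events \<open>r k = a\<close> transitively, so an invariant event \<open>A\<close> meets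
  all of them with the same probability. Hence \<open>A\<close> is independent of every such event, so of every
  event, and in particular of itself.\<close>

theorem odometer_ergodic:
  fixes A :: "(nat \<Rightarrow> 'd::finite site) set"
  assumes A: "A \<in> sets residue_space" and inv: "\<And>z. rotate_residues z -` A = A"
  shows "measure odometer A = 0 \<or> measure odometer A = 1"
proof -
  interpret prob_space "odometer :: (nat \<Rightarrow> 'd site) measure" by (rule prob_space_odometer)
  have slice: "prob (X \<inter> {r. r k = a}) = prob X / card (residue_box k :: 'd site set)"
    if a: "a \<in> residue_box k" and X [measurable]: "X \<in> sets residue_space" and inv: "\<And>z. rotate_residues z -` X = X" for X k and a :: "'d site"
  proof -
    have mX: "X \<inter> {r. r k = b} \<in> sets residue_space" for b using X sets_residue_eq by auto
    have const: "prob (X \<inter> {r. r k = b}) = prob (X \<inter> {r. r k = a})" if b: "b \<in> residue_box k" for b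
    proof -
      have "prob (X \<inter> {r. r k = b}) = measure (distr odometer odometer (rotate_residues (b - a))) (X \<inter> {r. r k = b})"
        by (simp add: distr_rotate_residues)
      also have "\<dots> = prob (rotate_residues (b - a) -` (X \<inter> {r. r k = b}))"
        using mX by (subst measure_distr) auto
      also have "rotate_residues (b - a) -` (X \<inter> {r. r k = b}) = X \<inter> {r. rotate_residues (b - a) r k = b}"
        using inv[of "b - a"] by auto
      also have "prob \<dots> = prob (X \<inter> {r. r k = a})"
        using AE_compatible
      proof (intro measure_eq_AE)
        show "AE r in odometer. r \<in> X \<inter> {r. rotate_residues (b - a) r k = b} \<longleftrightarrow> r \<in> X \<inter> {r. r k = a}"
          using AE_compatible
          by eventually_elim (use a in \<open>simp add: rotate_residues_eq_iff[OF _ b] residue_box_def\<close>)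
        have "{r. rotate_residues (b - a) r k = b} \<in> sets residue_space" by (rule sets_residue_Collect) measurable
        then show "X \<inter> {r. rotate_residues (b - a) r k = b} \<in> events" using X by auto
      qed (use mX in auto)
      finally show ?thesis .
    qed
    have "prob X = prob (\<Union>b\<in>residue_box k. X \<inter> {r. r k = b})"
    proof (rule measure_eq_AE)
      show "AE r in odometer. r \<in> X \<longleftrightarrow> r \<in> (\<Union>b\<in>residue_box k. X \<inter> {r. r k = b})"
        using AE_compatible by eventually_elim (auto simp: compatible_box)
    qed (use mX X in auto)
    also have "\<dots> = (\<Sum>b\<in>residue_box k. prob (X \<inter> {r. r k = b}))"
      by (rule finite_measure_finite_Union) (use mX in \<open>auto simp: disjoint_family_on_def\<close>)
    also have "\<dots> = card (residue_box k :: 'd site set) * prob (X \<inter> {r. r k = a})"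
      by (simp add: const)
    finally have "prob X = card (residue_box k :: 'd site set) * prob (X \<inter> {r. r k = a})" .
    moreover have "card (residue_box k :: 'd site set) \<noteq> 0" using a by auto
    ultimately show ?thesis by (simp add: field_simps)
  qed
  have dens: "emeasure (density odometer (indicator A)) X = emeasure odometer (A \<inter> X)"
    if "X \<in> sets residue_space" for X
  proof -
    have "emeasure (density odometer (indicator A)) X = (\<integral>\<^sup>+ r. indicator A r * indicator X r \<partial>odometer)"
      using A that by (intro emeasure_density) auto
    also have "\<dots> = (\<integral>\<^sup>+ r. indicator (A \<inter> X) r \<partial>odometer)"
      by (simp only: indicator_inter_arith)
    also have "\<dots> = emeasure odometer (A \<inter> X)"
      using A that by (intro nn_integral_indicator) auto
    finally show ?thesis .
  qed
  have top: "UNIV \<in> sets residue_space" using sets.top[of residue_space] by simp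
  \<comment> \<open>Independence of \<open>A\<close> and all events, as an equality of measures.\<close>
  have "density odometer (indicator A) = scale_measure (emeasure odometer A) odometer"
  proof (rule residue_measure_eqI)
    have [measurable]: "A \<in> sets odometer" using A by simp
    show "finite_measure (density odometer (indicator A))"
      using dens[OF top] by (intro finite_measureI) (simp add: emeasure_eq_measure)
    show "AE r in density odometer (indicator A). compatible r"
      using AE_compatible by (subst AE_density) (auto elim: eventually_mono)
    show "AE r in scale_measure (emeasure odometer A) odometer. compatible r"
      using AE_compatible unfolding eventually_ae_filter null_sets_def by auto
    fix k and a :: "'d site" assume a: "a \<in> residue_box k"
    have "emeasure (density odometer (indicator A)) {r. r k = a} = emeasure odometer (A \<inter> {r. r k = a})"
      by (rule dens[OF sets_residue_eq])
    also have "\<dots> = emeasure odometer A * emeasure odometer {r. r k = a}"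
      using slice[OF a A inv] slice[OF a top] prob_space
      by (simp add: emeasure_eq_measure ennreal_mult[symmetric])
    finally show "emeasure (density odometer (indicator A)) {r. r k = a} =
      emeasure (scale_measure (emeasure odometer A) odometer) {r. r k = a}"
      by simp
  qed auto
  then have "emeasure (density odometer (indicator A)) A = emeasure (scale_measure (emeasure odometer A) odometer) A"
    by simp
  then have "emeasure odometer A = emeasure odometer A * emeasure odometer A"
    using dens[OF A] by simp
  then have "prob A = prob A * prob A"
    by (simp add: emeasure_eq_measure ennreal_mult[symmetric])
  then show ?thesis by simp
qed

section \<open>An environment of insulated line segments\<close>

text \<open>Segments run in direction \<open>i1\<close>, and coordinate \<open>i2\<close> keeps the scales apart. The strong and the weak
  conductance of scale \<open>k\<close> are \<open>A ^ k\<close> and \<open>1 / B ^ k\<close>.\<close>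

locale line_model =
  fixes i1 i2 :: "'d::finite" and A B :: real
  assumes i12: "i1 \<noteq> i2" and A1: "1 \<le> A" and B1: "1 \<le> B"
begin

text \<open>Here \<open>v\<close> is a position relative to the random origin. Coordinate \<open>i2\<close> has 2-adic valuation exactly
  \<open>k - 1\<close>, which identifies the scale. Scales start at \<open>2\<close> so that coordinate \<open>i2\<close> is even and
  neighbouring sites cannot belong to different scales.\<close>

definition on_line :: "nat \<Rightarrow> 'd site \<Rightarrow> bool" where
  "on_line k v \<longleftrightarrow> 2 \<le> k \<and> v $ i2 mod 2 ^ k = 2 ^ (k - 1) \<and>
     (\<forall>i. i \<noteq> i1 \<longrightarrow> i \<noteq> i2 \<longrightarrow> v $ i mod 2 ^ k = 0)"

text \<open>A line of scale \<open>k\<close> is cut into segments of \<open>2 ^ k\<close> sites. The cuts matter: an uncut line could carry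
  a constant current along which a potential grows linearly.\<close>

definition same_segment :: "nat \<Rightarrow> 'd site \<Rightarrow> 'd site \<Rightarrow> bool" where
  "same_segment k v w \<longleftrightarrow> on_line k v \<and> on_line k w \<and> v $ i1 div 2 ^ k = w $ i1 div 2 ^ k"

definition touches :: "(nat \<Rightarrow> 'd site) \<Rightarrow> 'd site \<Rightarrow> 'd site \<Rightarrow> nat \<Rightarrow> bool" where
  "touches r x y k \<longleftrightarrow> on_line k (r k + x) \<or> on_line k (r k + y)"

definition weight :: "nat \<Rightarrow> (nat \<Rightarrow> 'd site) \<Rightarrow> 'd site \<Rightarrow> 'd site \<Rightarrow> real" where
  "weight k r x y = (if same_segment k (r k + x) (r k + y) then A ^ k else 1 / B ^ k)"

text \<open>For a compatible sequence an edge touches lines of at most one scale (see \<open>env_on_line\<close>).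
  Taking the least scale makes the environment well defined, measurable and covariant for all
  sequences.\<close>

definition env :: "(nat \<Rightarrow> 'd site) \<Rightarrow> 'd conf" where
  "env r = (\<lambda>(x, y).
     if y - x \<notin> unit_sites then 0
     else if \<exists>k. touches r x y k then weight (LEAST k. touches r x y k) r x y else 1)"

lemma on_line_cong:
  assumes "\<And>i. v $ i mod 2 ^ k = w $ i mod 2 ^ k"
  shows "on_line k v \<longleftrightarrow> on_line k w"
  by (simp add: on_line_def assms)

lemma on_line_reduce: "on_line k (reduce k u + x) \<longleftrightarrow> on_line k (u + x)"
  by (rule on_line_cong) (simp add: mod_add_left_eq)

lemma same_segment_reduce: "same_segment k (reduce k u + x) (reduce k u + y) \<longleftrightarrow> same_segment k (u + x) (u + y)"
proof -
  have "(reduce k u + z) $ i1 div 2 ^ k = (u + z) $ i1 div 2 ^ k - u $ i1 div 2 ^ k" for z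
  proof -
    have "(u + z) $ i1 = (reduce k u + z) $ i1 + u $ i1 div 2 ^ k * 2 ^ k"
      by (simp add: algebra_simps)
    also have "\<dots> div 2 ^ k = (reduce k u + z) $ i1 div 2 ^ k + u $ i1 div 2 ^ k"
      by (subst div_mult_self1) simp_all
    finally show ?thesis by simp
  qed
  then show ?thesis unfolding same_segment_def on_line_reduce by simp
qed

lemma touches_rotate: "touches (rotate_residues z r) x y = touches r (x + z) (y + z)"
  by (simp add: fun_eq_iff touches_def rotate_residues_def on_line_reduce add.assoc add.commute[of z])

lemma weight_rotate: "weight k (rotate_residues z r) x y = weight k r (x + z) (y + z)"
  by (simp add: weight_def rotate_residues_def same_segment_reduce add.assoc add.commute[of z])

text \<open>The environment depends on \<open>r k\<close> only modulo \<open>2 ^ k\<close>, so reducing after the addition of \<open>z\<close> does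
  not change it.\<close>

lemma env_rotate: "env (rotate_residues z r) = translate z (env r)"
  by (auto simp: fun_eq_iff env_def translate_def touches_rotate weight_rotate)

lemma touches_commute: "touches r x y = touches r y x"
  by (auto simp: touches_def fun_eq_iff)

lemma weight_commute: "weight k r x y = weight k r y x"
  by (auto simp: weight_def same_segment_def)

lemma weight_pos: "0 < weight k r x y"
  using A1 B1 by (simp add: weight_def)

lemma env_pos: "y - x \<in> unit_sites \<Longrightarrow> 0 < env r (x, y)"
  by (simp add: env_def weight_pos)

lemma env_in_nn_confs: "env r \<in> nn_confs"
  unfolding nn_confs_def
proof (intro CollectI conjI allI impI)
  fix x y
  show "0 \<le> env r (x, y)" by (simp add: env_def less_imp_le[OF weight_pos])
  have "x - y \<in> unit_sites \<longleftrightarrow> y - x \<in> unit_sites" using minus_in_unit_sites[of "y - x"] by simp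
  then show "env r (x, y) = env r (y, x)"
    by (auto simp: env_def touches_commute[of r y] weight_commute[of _ r y])
  then show "env r (x, y) = 0" if "norm (rvec (x - y)) \<noteq> 1"
    using that by (simp add: env_def unit_sites_def)
qed

lemma measurable_env [measurable]: "env \<in> residue_space \<rightarrow>\<^sub>M conf_space"
  unfolding conf_space_def
proof (rule measurable_restrict_space2)
  show "env \<in> space residue_space \<rightarrow> nn_confs" using env_in_nn_confs by simp
  show "env \<in> residue_space \<rightarrow>\<^sub>M PiM UNIV (\<lambda>_. borel)"
  proof (rule measurable_PiM_single')
    fix xy :: "'d site \<times> 'd site"
    obtain x y where xy: "xy = (x, y)" by fastforce
    have [measurable]: "Measurable.pred residue_space (\<lambda>r. touches r x y k)" for k
      unfolding touches_def by measurable
    have w: "(\<lambda>r. weight k r x y) \<in> borel_measurable residue_space" for k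
      unfolding weight_def by measurable
    have [measurable]: "(\<lambda>r. weight (LEAST k. touches r x y k) r x y) \<in> borel_measurable residue_space"
      by (rule measurable_compose_countable[where f = "\<lambda>k r. weight k r x y", OF w]) measurable
    show "(\<lambda>r. env r xy) \<in> borel_measurable residue_space"
      unfolding env_def xy by simp
  qed auto
qed

definition law :: "'d conf measure" where
  "law = distr odometer conf_space env"

lemma sets_law: "sets law = sets conf_space"
  by (simp add: law_def)

lemma measurable_env_odometer [measurable]: "env \<in> odometer \<rightarrow>\<^sub>M conf_space"
  by measurable

lemma conductance_law_law: "conductance_law law"
  unfolding conductance_law_def law_def
  by (auto intro: prob_space.prob_space_distr[OF prob_space_odometer])

lemma space_law: "space law = nn_confs"
  by (simp add: law_def conf_space_def space_restrict_space space_PiM)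

lemma stationary_law: "stationary law"
  unfolding stationary_def
proof
  fix z
  have "distr law law (translate z) = distr law conf_space (translate z)"
    by (rule distr_cong) (simp_all add: sets_law)
  also have "\<dots> = distr odometer conf_space (translate z \<circ> env)"
    unfolding law_def by (rule distr_distr[OF measurable_translate_conf_space measurable_env_odometer])
  also have "translate z \<circ> env = env \<circ> rotate_residues z"
    by (simp add: fun_eq_iff env_rotate)
  also have "distr odometer conf_space (env \<circ> rotate_residues z) =
      distr (distr odometer odometer (rotate_residues z)) conf_space env"
    by (rule distr_distr[symmetric]) measurable
  also have "\<dots> = law" unfolding distr_rotate_residues law_def ..
  finally show "distr law law (translate z) = law" .
qed

lemma jointly_ergodic_law: "jointly_ergodic law"
  unfolding jointly_ergodic_def
proof (intro ballI impI)
  fix S assume S: "S \<in> sets law" and inv: "\<forall>z. translate z -` S \<inter> space law = S"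
  have meas: "env -` S \<in> sets residue_space"
    using measurable_sets[OF measurable_env, of S] S by (simp add: sets_law)
  have "rotate_residues z -` (env -` S) = env -` S" for z
  proof -
    have "env r \<in> S \<longleftrightarrow> translate z (env r) \<in> S" for r
    proof -
      have "env r \<in> S \<longleftrightarrow> env r \<in> translate z -` S \<inter> space law" using inv by simp
      then show ?thesis by (simp add: space_law env_in_nn_confs)
    qed
    then show ?thesis by (auto simp: env_rotate)
  qed
  from odometer_ergodic[OF meas this]
  show "measure law S = 0 \<or> measure law S = 1"
    using S by (simp add: law_def measure_distr)
qed

text \<open>All coordinates but \<open>i1\<close> of a residue of a site on a line are prescribed, so there are at most
  \<open>2 ^ k\<close> such residues out of \<open>2 ^ (k * d)\<close>.\<close>

lemma emeasure_on_line_le: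
  "emeasure odometer {r. on_line k (r k + x)} \<le> ennreal (2 ^ k * (1 / 2 ^ CARD('d)) ^ k)"
proof -
  define V where "V = {v \<in> residue_box k. on_line k (v + x)}"
  have fin: "finite V" by (simp add: V_def)
  have "inj_on (\<lambda>v. v $ i1) V"
  proof (rule inj_onI)
    fix v w assume v: "v \<in> V" and w: "w \<in> V" and eq: "v $ i1 = w $ i1"
    have "v $ i = w $ i" for i
    proof (cases "i = i1")
      case False
      have "(v $ i + x $ i) mod 2 ^ k = (w $ i + x $ i) mod 2 ^ k"
        using v w False by (cases "i = i2") (auto simp: V_def on_line_def)
      then have "v $ i mod 2 ^ k = w $ i mod 2 ^ k"
        by (metis add_diff_cancel_right' mod_diff_left_eq)
      then show ?thesis using v w by (simp add: V_def residue_box_nth)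
    qed (use eq in simp)
    then show "v = w" by (simp add: vec_eq_iff)
  qed
  then have "card V = card ((\<lambda>v. v $ i1) ` V)" by (rule card_image[symmetric])
  also have "\<dots> \<le> card {0..<2 ^ k :: int}"
    by (rule card_mono) (auto simp: V_def residue_boxD)
  finally have card: "card V \<le> 2 ^ k" by (simp add: nat_power_eq)
  have "emeasure odometer {r. on_line k (r k + x)} = emeasure odometer (\<Union>v\<in>V. {r. r k = v})"
  proof (rule emeasure_eq_AE)
    show "AE r in odometer. r \<in> {r. on_line k (r k + x)} \<longleftrightarrow> r \<in> (\<Union>v\<in>V. {r. r k = v})"
      using AE_compatible by eventually_elim (auto simp: V_def compatible_box)
    show "{r. on_line k (r k + x)} \<in> sets odometer"
      unfolding sets_odometer by (rule sets_residue_Collect) measurable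
    show "(\<Union>v\<in>V. {r. r k = v}) \<in> sets odometer"
      unfolding sets_odometer using fin sets_residue_eq by (intro sets.finite_UN) auto
  qed
  also have "\<dots> \<le> (\<Sum>v\<in>V. emeasure odometer {r. r k = v})"
    using fin sets_residue_eq by (intro emeasure_subadditive_finite) auto
  also have "\<dots> = (\<Sum>v\<in>V. ennreal ((1 / 2 ^ CARD('d)) ^ k))"
    by (intro sum.cong refl emeasure_odometer_residue) (simp add: V_def)
  also have "\<dots> = ennreal (card V * (1 / 2 ^ CARD('d)) ^ k)"
    by (simp add: ennreal_mult ennreal_of_nat_eq_real_of_nat)
  also have "\<dots> \<le> ennreal (2 ^ k * (1 / 2 ^ CARD('d)) ^ k)"
  proof (intro ennreal_leI mult_right_mono)
    show "real (card V) \<le> 2 ^ k" using card by (metis of_nat_le_iff of_nat_numeral of_nat_power)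
  qed simp
  finally show ?thesis .
qed

lemma measurable_touches [measurable]: "Measurable.pred residue_space (\<lambda>r. touches r x y k)"
  unfolding touches_def by measurable

text \<open>The probabilities decay like \<open>2 ^ (- k * (d - 1))\<close>, so the series is geometric.\<close>

lemma nn_integral_touches:
  assumes "0 \<le> s" and s: "s < 2 ^ (CARD('d) - 1)"
  shows "(\<integral>\<^sup>+r. (\<Sum>k. ennreal (s ^ k) * indicator {r. touches r x y k} r) \<partial>odometer) < \<infinity>"
proof -
  let ?c = "1 / 2 ^ CARD('d) :: real"
  let ?q = "s * (2 * ?c)"
  have q: "0 \<le> ?q" "?q < 1"
  proof -
    have "CARD('d) = Suc (CARD('d) - 1)" using zero_less_card_finite[where 'a = 'd] by simp
    then have "(2 :: real) ^ CARD('d) = 2 * 2 ^ (CARD('d) - 1)" by (metis power_Suc)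
    then show "?q < 1" using s by (simp add: divide_simps)
  qed (use assms in simp)
  have setT: "{r. touches r x y k} \<in> sets residue_space" for k by (rule sets_residue_Collect) measurable
  have T: "emeasure odometer {r. touches r x y k} \<le> ennreal (2 * (2 ^ k * ?c ^ k))" for k
  proof -
    have "{r. touches r x y k} = {r. on_line k (r k + x)} \<union> {r. on_line k (r k + y)}"
      by (auto simp: touches_def)
    also have "emeasure odometer \<dots> \<le>
        emeasure odometer {r. on_line k (r k + x)} + emeasure odometer {r. on_line k (r k + y)}"
      by (rule emeasure_subadditive; unfold sets_odometer; rule sets_residue_Collect; measurable)
    also have "\<dots> \<le> ennreal (2 ^ k * ?c ^ k) + ennreal (2 ^ k * ?c ^ k)"
      by (intro add_mono emeasure_on_line_le)
    also have "\<dots> = ennreal (2 * (2 ^ k * ?c ^ k))"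
      by (subst ennreal_plus[symmetric]) auto
    finally show ?thesis .
  qed
  have "(\<integral>\<^sup>+r. (\<Sum>k. ennreal (s ^ k) * indicator {r. touches r x y k} r) \<partial>odometer) =
    (\<Sum>k. \<integral>\<^sup>+r. ennreal (s ^ k) * indicator {r. touches r x y k} r \<partial>odometer)"
    using setT by (intro nn_integral_suminf) auto
  also have "\<dots> = (\<Sum>k. ennreal (s ^ k) * emeasure odometer {r. touches r x y k})"
    using setT by (intro suminf_cong nn_integral_cmult_indicator) auto
  also have "\<dots> \<le> (\<Sum>k. ennreal (s ^ k) * ennreal (2 * (2 ^ k * ?c ^ k)))"
    by (intro suminf_le mult_left_mono T) auto
  also have "\<dots> = (\<Sum>k. ennreal (2 * ?q ^ k))"
  proof (intro suminf_cong)
    fix k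
    have "s ^ k * (2 * (2 ^ k * c ^ k)) = 2 * (s * (2 * c)) ^ k" for c :: real
      by (simp add: power_mult_distrib)
    from this[of ?c] show "ennreal (s ^ k) * ennreal (2 * (2 ^ k * ?c ^ k)) = ennreal (2 * ?q ^ k)"
      by (subst ennreal_mult[symmetric]) (use \<open>0 \<le> s\<close> in simp_all)
  qed
  also have "\<dots> = ennreal (\<Sum>k. 2 * ?q ^ k)"
    using q by (intro suminf_ennreal2) (auto intro!: summable_mult summable_geometric simp del: times_divide_eq_right)
  also have "\<dots> < \<infinity>" by simp
  finally show ?thesis .
qed

text \<open>One bound for both moment conditions: \<open>f\<close> will be \<open>c \<mapsto> c powr p\<close> and \<open>c \<mapsto> (1 / c) powr q\<close>.\<close>

lemma nn_integral_env_bound: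
  fixes f :: "real \<Rightarrow> real"
  assumes [measurable]: "f \<in> borel_measurable borel"
    and xy: "y - x \<in> unit_sites"
    and f1: "f 1 \<le> 1" and le: "\<And>k. f (A ^ k) \<le> s ^ k" "\<And>k. f (1 / B ^ k) \<le> s ^ k"
    and s: "0 \<le> s" "s < 2 ^ (CARD('d) - 1)"
  shows "(\<integral>\<^sup>+\<omega>. ennreal (f (\<omega> (x, y))) \<partial>law) < \<infinity>"
proof -
  interpret prob_space odometer by (rule prob_space_odometer)
  have [measurable]: "(\<lambda>\<omega>. \<omega> (x, y)) \<in> borel_measurable conf_space"
    by (rule measurable_conf_space_coord)
  have setT: "{r. touches r x y k} \<in> sets residue_space" for k by (rule sets_residue_Collect) measurable
  have le_suminf: "h j \<le> suminf h" for h :: "nat \<Rightarrow> ennreal" and j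
    using sum_le_suminf[of h "{j}"] by simp
  let ?S = "\<lambda>r. \<Sum>k. ennreal (s ^ k) * indicator {r. touches r x y k} r"
  have "(\<integral>\<^sup>+\<omega>. ennreal (f (\<omega> (x, y))) \<partial>law) = (\<integral>\<^sup>+r. ennreal (f (env r (x, y))) \<partial>odometer)"
    unfolding law_def by (rule nn_integral_distr) measurable
  also have "\<dots> \<le> (\<integral>\<^sup>+r. 1 + ?S r \<partial>odometer)"
  proof (rule nn_integral_mono)
    fix r
    show "ennreal (f (env r (x, y))) \<le> 1 + ?S r"
    proof (cases "\<exists>k. touches r x y k")
      case False
      then have "ennreal (f (env r (x, y))) \<le> 1" using xy f1 by (auto simp: env_def)
      also have "\<dots> \<le> 1 + ?S r" by simp
      finally show ?thesis .
    next
      case True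
      define k where "k = (LEAST k. touches r x y k)"
      have k: "touches r x y k" unfolding k_def using True by (rule LeastI_ex)
      have "env r (x, y) = weight k r x y" using True xy by (simp add: env_def k_def)
      then have "ennreal (f (env r (x, y))) \<le> ennreal (s ^ k) * indicator {r. touches r x y k} r"
        using k le[of k] by (auto simp: weight_def intro: ennreal_leI)
      also have "\<dots> \<le> ?S r"
        by (rule le_suminf)
      also have "\<dots> \<le> 1 + ?S r" by simp
      finally show ?thesis .
    qed
  qed
  also have "\<dots> = 1 + (\<integral>\<^sup>+r. ?S r \<partial>odometer)"
    using setT emeasure_space_1 by (subst nn_integral_add) auto
  also have "\<dots> < \<infinity>"
    using nn_integral_touches[OF s, of x y] by (simp add: ennreal_add_eq_top less_top)
  finally show ?thesis .
qed

lemma power_powr_eq: "0 < (c::real) \<Longrightarrow> (c ^ k) powr p = (c powr p) ^ k"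
  by (simp add: powr_power powr_realpow[symmetric] powr_powr mult.commute)

lemma in_Lp_conductance:
  assumes p: "0 \<le> p" and A: "A powr p < 2 ^ (CARD('d) - 1)" and e: "e \<in> unit_sites"
  shows "in_Lp law p (\<lambda>\<omega>. \<omega> (0, e))"
proof -
  have [measurable]: "(\<lambda>\<omega>. \<omega> (0, e)) \<in> borel_measurable law"
    unfolding measurable_cong_sets[OF sets_law refl] by (rule measurable_conf_space_coord)
  have A1p: "1 \<le> A powr p" using A1 p by (simp add: ge_one_powr_ge_zero)
  have "(\<integral>\<^sup>+\<omega>. ennreal (\<bar>\<omega> (0, e)\<bar> powr p) \<partial>law) < \<infinity>"
  proof (rule nn_integral_env_bound[where f = "\<lambda>c. \<bar>c\<bar> powr p", OF _ _ _ _ _ _ A])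
    show "\<bar>A ^ k\<bar> powr p \<le> (A powr p) ^ k" for k using A1 by (simp add: power_powr_eq)
    fix k
    have "\<bar>1 / B ^ k\<bar> powr p \<le> 1 powr p" using B1 p by (intro powr_mono2) auto
    also have "\<dots> \<le> (A powr p) ^ k" using A1p by simp
    finally show "\<bar>1 / B ^ k\<bar> powr p \<le> (A powr p) ^ k" .
  qed (use e in auto)
  then show ?thesis unfolding in_Lp_def by (auto intro!: integrableI_bounded)
qed

lemma in_Lp_resistance:
  assumes q: "0 \<le> q" and B: "B powr q < 2 ^ (CARD('d) - 1)" and e: "e \<in> unit_sites"
  shows "in_Lp law q (\<lambda>\<omega>. 1 / \<omega> (0, e))"
proof -
  have [measurable]: "(\<lambda>\<omega>. \<omega> (0, e)) \<in> borel_measurable law"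
    unfolding measurable_cong_sets[OF sets_law refl] by (rule measurable_conf_space_coord)
  have B1q: "1 \<le> B powr q" using B1 q by (simp add: ge_one_powr_ge_zero)
  have "(\<integral>\<^sup>+\<omega>. ennreal (\<bar>1 / \<omega> (0, e)\<bar> powr q) \<partial>law) < \<infinity>"
  proof (rule nn_integral_env_bound[where f = "\<lambda>c. \<bar>1 / c\<bar> powr q", OF _ _ _ _ _ _ B])
    show "\<bar>1 / (1 / B ^ k)\<bar> powr q \<le> (B powr q) ^ k" for k using B1 by (simp add: power_powr_eq)
    fix k
    have "\<bar>1 / A ^ k\<bar> powr q \<le> 1 powr q" using A1 q by (intro powr_mono2) auto
    also have "\<dots> \<le> (B powr q) ^ k" using B1q by simp
    finally show "\<bar>1 / A ^ k\<bar> powr q \<le> (B powr q) ^ k" .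
  qed (use e in auto)
  then show ?thesis unfolding in_Lp_def by (auto intro!: integrableI_bounded)
qed

lemma AE_law_iff_odometer:
  assumes "AE \<omega> in law. Q \<omega>"
  shows "AE r in odometer. Q (env r)"
  using assms unfolding law_def by (rule AE_distrD[OF measurable_env_odometer])

lemma AE_law_pos: "e \<in> unit_sites \<Longrightarrow> AE \<omega> in law. 0 < \<omega> (0, e)"
proof -
  assume e: "e \<in> unit_sites"
  have [measurable]: "(\<lambda>\<omega>. \<omega> (0, e)) \<in> borel_measurable (conf_space :: 'd conf measure)"
    by (rule measurable_conf_space_coord)
  have "(AE \<omega> in law. 0 < \<omega> (0, e)) \<longleftrightarrow> (AE r in odometer. 0 < env r (0, e))"
    unfolding law_def by (rule AE_distr_iff[OF measurable_env_odometer]) measurable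
  then show ?thesis using e by (simp add: env_pos)
qed

end

section \<open>Failure of sublinearity\<close>

text \<open>A discrete function on \<open>N\<close> points whose second differences are at most \<open>c\<close>, and whose first increment
  is at most \<open>c\<close>: increments grow at most linearly. The case distinction treats the first increment
  as a second difference with an insulated left end.\<close>

lemma norm_endpoints_le:
  fixes f :: "nat \<Rightarrow> 'a::real_normed_vector"
  assumes "0 \<le> c"
    and c: "\<And>j. Suc j < N \<Longrightarrow>
      norm ((f (Suc j) - f j) - (if 0 < j then f j - f (j - 1) else 0)) \<le> c"
  shows "norm (f (N - 1) - f 0) \<le> (real N)\<^sup>2 * c"
proof -
  have step: "norm (f (Suc j) - f j) \<le> real (Suc j) * c" if "Suc j < N" for j
    using that
  proof (induction j)
    case 0 then show ?case using c[of 0] by simp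
  next
    case (Suc j)
    have "norm (f (Suc (Suc j)) - f (Suc j)) \<le>
        norm ((f (Suc (Suc j)) - f (Suc j)) - (f (Suc j) - f j)) + norm (f (Suc j) - f j)"
      using norm_triangle_ineq[of "(f (Suc (Suc j)) - f (Suc j)) - (f (Suc j) - f j)" "f (Suc j) - f j"] by simp
    also have "\<dots> \<le> c + real (Suc j) * c" using c[of "Suc j"] Suc by (intro add_mono) simp_all
    finally show ?case by (simp add: algebra_simps)
  qed
  have "f (N - 1) - f 0 = (\<Sum>j<N - 1. f (Suc j) - f j)" by (simp add: sum_lessThan_telescope)
  also have "norm \<dots> \<le> (\<Sum>j<N - 1. real N * c)"
  proof (rule sum_norm_le)
    fix j assume "j \<in> {..<N - 1}"
    then have j: "Suc j < N" by simp
    then have "real (Suc j) * c \<le> real N * c" using \<open>0 \<le> c\<close> by (intro mult_right_mono) auto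
    with step[OF j] show "norm (f (Suc j) - f j) \<le> real N * c" by linarith
  qed
  also have "\<dots> = real (N - 1) * (real N * c)" by simp
  also have "\<dots> \<le> real N * (real N * c)" using \<open>0 \<le> c\<close> by (intro mult_right_mono) auto
  finally show ?thesis by (simp add: power2_eq_square mult.assoc)
qed

lemma axis_add: "axis i (a :: int) + axis i b = axis i (a + b)"
  by (simp add: vec_eq_iff axis_def)

lemma unit_site_nth: "unit_site j $ i = (if i = fst j then if snd j then 1 else - 1 else 0)"
  by (simp add: unit_site_def axis_def)

lemma abs_unit_site_nth_le: "\<bar>unit_site j $ i\<bar> \<le> 1"
  by (simp add: unit_site_nth)

context line_model
begin

text \<open>The valuations of coordinate \<open>i2\<close> at \<open>x\<close> and \<open>y\<close> are \<open>k - 1\<close> and \<open>l - 1\<close>. If \<open>l < k\<close>, the difference of the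
  two coordinates has valuation \<open>l - 1 \<ge> 1\<close>, and then it is not in \<open>{-1, 0, 1}\<close>.\<close>

lemma on_line_levels_not_less:
  assumes r: "compatible r" and x: "on_line k (r k + x)" and y: "on_line l (r l + y)"
    and near: "\<bar>(y - x) $ i2\<bar> \<le> 1"
  shows "\<not> l < k"
proof
  assume "l < k"
  define u where "u = r k $ i2"
  have rl: "r l = reduce l (r k)" using compatibleD[OF r] \<open>l < k\<close> by simp
  have l2: "2 \<le> l" using y by (simp add: on_line_def)
  have "(u mod 2 ^ l + y $ i2) mod 2 ^ l = 2 ^ (l - 1)"
    using y by (simp add: on_line_def rl u_def)
  then have uy: "(u + y $ i2) mod 2 ^ l = 2 ^ (l - 1)" by (simp add: mod_add_left_eq)
  have "(u + x $ i2) mod 2 ^ k = 2 ^ (k - 1)" using x by (simp add: on_line_def u_def)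
  then have "(u + x $ i2) mod 2 ^ l = 2 ^ (k - 1) mod 2 ^ l"
    using mod_power2_mod_power2[of l k "u + x $ i2"] \<open>l < k\<close> by simp
  moreover have "(2 :: int) ^ l dvd 2 ^ (k - 1)" using \<open>l < k\<close> by (intro le_imp_power_dvd) simp
  ultimately have ux: "(u + x $ i2) mod 2 ^ l = 0" by (simp add: dvd_imp_mod_0)
  have "(y - x) $ i2 mod 2 ^ l = ((u + y $ i2) - (u + x $ i2)) mod 2 ^ l" by simp
  also have "\<dots> = (2 ^ (l - 1) - 0) mod 2 ^ l"
    by (metis mod_diff_eq uy ux mod_mod_trivial mod_0)
  also have "\<dots> = 2 ^ (l - 1)" using l2 by (simp add: mod_pos_pos_trivial)
  finally have m: "(y - x) $ i2 mod 2 ^ l = 2 ^ (l - 1)" .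
  obtain n where n: "l = Suc (Suc n)" using l2 by (metis add_2_eq_Suc le_Suc_ex)
  have "1 \<le> (2 :: int) ^ n" by simp
  from near consider "(y - x) $ i2 = -1" | "(y - x) $ i2 = 0" | "(y - x) $ i2 = 1" by linarith
  then show False
  proof cases
    case 1
    have "(- 1 :: int) mod 2 ^ l = 2 ^ l - 1" by (simp add: zmod_minus1)
    with m 1 have "(2 :: int) ^ l - 1 = 2 ^ (l - 1)" by simp
    then show False using \<open>1 \<le> 2 ^ n\<close> by (simp add: n)
  next
    case 2 then show False using m by simp
  next
    case 3
    have "(1 :: int) mod 2 ^ l = 1" using l2 by (intro mod_pos_pos_trivial) simp_all
    with m 3 have "(1 :: int) = 2 ^ (l - 1)" by simp
    then show False using \<open>1 \<le> 2 ^ n\<close> by (simp add: n)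
  qed
qed

lemma env_on_line:
  assumes r: "compatible r" and x: "on_line k (r k + x)" and y: "y - x \<in> unit_sites"
  shows "env r (x, y) = weight k r x y"
proof -
  have near: "\<bar>(y - x) $ i2\<bar> \<le> 1" "\<bar>(x - y) $ i2\<bar> \<le> 1"
  proof -
    obtain p where "y - x = unit_site p" using y by (rule unit_sitesE)
    then show "\<bar>(y - x) $ i2\<bar> \<le> 1" by (simp only: abs_unit_site_nth_le)
    then show "\<bar>(x - y) $ i2\<bar> \<le> 1" by (simp add: abs_minus_commute)
  qed
  have uniq: "l = k" if "touches r x y l" for l
    using that unfolding touches_def
  proof
    assume "on_line l (r l + x)"
    then show ?thesis
      using on_line_levels_not_less[OF r x, of l x] on_line_levels_not_less[OF r _ x, of l x] by force
  next
    assume "on_line l (r l + y)"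
    then show ?thesis
      using on_line_levels_not_less[OF r x _ near(1), of l] on_line_levels_not_less[OF r _ x near(2), of l] by force
  qed
  have "touches r x y k" using x by (simp add: touches_def)
  then have "(LEAST k. touches r x y k) = k" using uniq by (metis LeastI)
  then show ?thesis using y \<open>touches r x y k\<close> by (auto simp: env_def)
qed

text \<open>The first site of a segment of scale \<open>k\<close> that is within distance of order \<open>2 ^ k\<close> of the origin.\<close>

definition segment_origin :: "nat \<Rightarrow> (nat \<Rightarrow> 'd site) \<Rightarrow> 'd site" where
  "segment_origin k r = axis i2 (2 ^ (k - 1)) - r k"

definition segment_site :: "nat \<Rightarrow> (nat \<Rightarrow> 'd site) \<Rightarrow> nat \<Rightarrow> 'd site" where
  "segment_site k r j = segment_origin k r + axis i1 (int j)"

lemma segment_site_nth: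
  "(r k + segment_site k r j) $ i = (if i = i1 then int j else if i = i2 then 2 ^ (k - 1) else 0)"
  using i12 by (simp add: segment_site_def segment_origin_def axis_def)

lemma on_line_segment_site:
  assumes "2 \<le> k"
  shows "on_line k (r k + segment_site k r j)"
  using assms i12 unfolding on_line_def segment_site_nth by (auto simp: mod_pos_pos_trivial)

lemma same_segment_unit_site_iff:
  assumes k: "2 \<le> k" and j: "j < 2 ^ k"
  shows "same_segment k (r k + segment_site k r j) (r k + (segment_site k r j + unit_site (i, s))) \<longleftrightarrow>
    i = i1 \<and> (if s then Suc j < 2 ^ k else 0 < j)"
proof -
  let ?v = "r k + segment_site k r j"
  let ?e = "unit_site (i, s)"
  have v: "on_line k ?v" by (rule on_line_segment_site[OF k])
  have e: "?e $ i = (if s then 1 else -1)" by (simp add: unit_site_nth)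
  have pow: "(4 :: int) \<le> 2 ^ k"
    using power_increasing[OF k, of "2 :: int"] by simp
  have off: "\<not> on_line k (?v + ?e)" if "i \<noteq> i1"
  proof
    assume w: "on_line k (?v + ?e)"
    have "(?v + ?e) $ i mod 2 ^ k = ?v $ i mod 2 ^ k"
      using v w that by (cases "i = i2") (simp_all add: on_line_def)
    then have "(2 :: int) ^ k dvd (?v + ?e) $ i - ?v $ i" by (rule mod_eq_dvd_iff[THEN iffD1])
    then have "(2 :: int) ^ k dvd (if s then 1 else -1)" by (simp add: e)
    then have "(2 :: int) ^ k dvd 1" by (simp split: if_splits)
    then show False using pow by (auto dest: zdvd_imp_le)
  qed
  show ?thesis
  proof (cases "i = i1")
    case False
    then show ?thesis using off by (simp add: same_segment_def add.assoc)
  next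
    case True
    have w: "on_line k (?v + ?e)"
      using v i12 unfolding on_line_def by (auto simp: unit_site_nth True)
    have v1: "?v $ i1 = int j" by (simp only: segment_site_nth if_True simp_thms)
    have w1: "(?v + ?e) $ i1 = int j + (if s then 1 else -1)"
      using v1 e True by simp
    have jj: "int j < 2 ^ k" using j by (metis of_nat_less_iff of_nat_numeral of_nat_power)
    have z: "int j div 2 ^ k = 0" using jj by simp
    have "(int j + (if s then 1 else -1)) div 2 ^ k = 0 \<longleftrightarrow> (if s then Suc j < 2 ^ k else 0 < j)"
    proof (cases s)
      case True
      have "(int j + 1) div 2 ^ k = 0 \<longleftrightarrow> int (Suc j) < 2 ^ k"
        using jj by (simp add: zdiv_eq_0_iff add.commute)
      also have "\<dots> \<longleftrightarrow> Suc j < 2 ^ k"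
        by (metis of_nat_less_iff of_nat_numeral of_nat_power)
      finally show ?thesis using True by simp
    next
      case False
      have "(n - 1) div 2 ^ k = 0 \<longleftrightarrow> 0 < n" if "0 \<le> n" "n < 2 ^ k" for n :: int
        using that pow by (auto simp: zdiv_eq_0_iff)
      from this[OF _ jj] show ?thesis using False by simp
    qed
    moreover have "same_segment k ?v (?v + ?e) \<longleftrightarrow> (int j + (if s then 1 else -1)) div 2 ^ k = 0"
      using v w unfolding same_segment_def v1 w1 z by auto
    ultimately show ?thesis using True by (simp only: add.assoc simp_thms)
  qed
qed

text \<open>Current conservation at a site of the segment. The strong edges \<open>Z\<close> lead to the previous and the
  next site of the segment, if these exist. All other edges are weak and together carry a current
  of at most \<open>2 * d * M / B ^ k\<close>.\<close>

lemma segment_increments: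
  fixes M :: real
  assumes r: "compatible r" and k: "2 \<le> k" and j: "Suc j < 2 ^ k"
    and harm: "generator (env r) \<Psi> (segment_site k r j) = 0"
    and M: "\<And>e. e \<in> unit_sites \<Longrightarrow> norm (\<Psi> (segment_site k r j + e) - \<Psi> (segment_site k r j)) \<le> M"
  defines "f \<equiv> \<lambda>j. \<Psi> (segment_site k r j)"
  shows "norm ((f (Suc j) - f j) - (if 0 < j then f j - f (j - 1) else 0)) \<le> 2 * real CARD('d) * M / (A * B) ^ k"
proof -
  let ?x = "segment_site k r j"
  define g where "g p = \<Psi> (?x + unit_site p) - \<Psi> ?x" for p
  define Z where "Z = {p. fst p = i1 \<and> (if snd p then Suc j < 2 ^ k else 0 < j)}"
  have w: "env r (?x, ?x + unit_site p) = (if p \<in> Z then A ^ k else 1 / B ^ k)" for p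
  proof -
    have "env r (?x, ?x + unit_site p) = weight k r ?x (?x + unit_site p)"
      by (rule env_on_line[OF r on_line_segment_site[OF k, of r j]]) (simp add: unit_site_in)
    then show ?thesis
      using same_segment_unit_site_iff[OF k, of j r "fst p" "snd p"] j by (simp add: weight_def Z_def)
  qed
  have "(\<Sum>e\<in>unit_sites. env r (?x, ?x + e) *\<^sub>R (\<Psi> (?x + e) - \<Psi> ?x)) = 0"
    using harm by (subst (asm) generator_eq_0_iff[OF env_in_nn_confs]) (simp_all add: env_pos)
  then have "(\<Sum>p\<in>UNIV. env r (?x, ?x + unit_site p) *\<^sub>R g p) = 0"
    unfolding g_def by (subst (asm) sum.reindex_bij_betw[OF bij_betw_unit_site, symmetric])
  moreover have "(\<Sum>p\<in>UNIV. env r (?x, ?x + unit_site p) *\<^sub>R g p) =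
      A ^ k *\<^sub>R sum g Z + (1 / B ^ k) *\<^sub>R sum g (- Z)"
  proof -
    have "(\<Sum>p\<in>UNIV. env r (?x, ?x + unit_site p) *\<^sub>R g p) =
        (\<Sum>p\<in>UNIV - Z. env r (?x, ?x + unit_site p) *\<^sub>R g p) + (\<Sum>p\<in>Z. env r (?x, ?x + unit_site p) *\<^sub>R g p)"
      by (rule sum.subset_diff) simp_all
    also have "(\<Sum>p\<in>Z. env r (?x, ?x + unit_site p) *\<^sub>R g p) = A ^ k *\<^sub>R sum g Z"
      unfolding scaleR_sum_right by (rule sum.cong) (simp_all add: w)
    also have "(\<Sum>p\<in>UNIV - Z. env r (?x, ?x + unit_site p) *\<^sub>R g p) = (1 / B ^ k) *\<^sub>R sum g (- Z)"
      unfolding scaleR_sum_right Compl_eq_Diff_UNIV by (rule sum.cong) (simp_all add: w)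
    finally show ?thesis by (simp only: add.commute)
  qed
  ultimately have bal: "A ^ k *\<^sub>R sum g Z = - ((1 / B ^ k) *\<^sub>R sum g (- Z))"
    by (simp only: eq_neg_iff_add_eq_0)
  have A0: "0 < A ^ k" and B0: "0 < B ^ k" using A1 B1 by simp_all
  have "A ^ k * norm (sum g Z) = norm (A ^ k *\<^sub>R sum g Z)" using A0 by simp
  also have "\<dots> = norm (sum g (- Z)) / B ^ k" unfolding bal using B0 by simp
  finally have bal_norm: "A ^ k * norm (sum g Z) = norm (sum g (- Z)) / B ^ k" .
  have "S = T / (a * b)" if "a * S = T / b" "0 < a" "0 < b" for a b S T :: real
    using that by (simp add: field_simps)
  from this[OF bal_norm A0 B0] have nS: "norm (sum g Z) = norm (sum g (- Z)) / (A * B) ^ k"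
    by (simp only: power_mult_distrib)
  have "norm (sum g (- Z)) \<le> (\<Sum>p\<in>- Z. M)"
    unfolding g_def by (rule sum_norm_le, rule M, rule unit_site_in)
  also have "\<dots> \<le> (\<Sum>p\<in>(UNIV :: ('d \<times> bool) set). M)"
    using order_trans[OF norm_ge_zero M[OF unit_site_in]] by (intro sum_mono2) simp_all
  also have "\<dots> = 2 * real CARD('d) * M" by simp
  finally have T: "norm (sum g (- Z)) \<le> 2 * real CARD('d) * M" .
  have fS: "g (i1, True) = f (Suc j) - f j"
  proof -
    have "?x + unit_site (i1, True) = segment_site k r (Suc j)"
      by (simp add: segment_site_def unit_site_def add.assoc axis_add add.commute[of 1])
    then show ?thesis unfolding g_def f_def by (rule arg_cong)
  qed
  have fP: "g (i1, False) = f (j - 1) - f j" if "0 < j"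
  proof -
    have "?x + unit_site (i1, False) = segment_site k r (j - 1)"
      using that by (simp add: segment_site_def unit_site_def add.assoc axis_add of_nat_diff)
    then show ?thesis unfolding g_def f_def by (rule arg_cong)
  qed
  have Z: "Z = (if 0 < j then {(i1, True), (i1, False)} else {(i1, True)})"
    using j by (cases "0 < j") (auto simp: Z_def)
  have "sum g Z = (f (Suc j) - f j) - (if 0 < j then f j - f (j - 1) else 0)"
    unfolding Z by (simp add: fS fP)
  then have "norm ((f (Suc j) - f j) - (if 0 < j then f j - f (j - 1) else 0)) = norm (sum g (- Z)) / (A * B) ^ k"
    using nS by simp
  also have "\<dots> \<le> 2 * real CARD('d) * M / (A * B) ^ k"
    using T A1 B1 by (intro divide_right_mono) simp_all
  finally show ?thesis .
qed

lemma norm_segment_site_le: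
  assumes r: "compatible r" and k: "2 \<le> k" and j: "j < 2 ^ k"
  shows "norm (rvec (segment_site k r j)) \<le> CARD('d) * 2 ^ k"
proof -
  have "\<bar>segment_site k r j $ i\<bar> \<le> 2 ^ k" for i
  proof -
    have rk: "0 \<le> r k $ i" "r k $ i < 2 ^ k" using residue_boxD[OF compatible_box[OF r]] by auto
    have "int j < 2 ^ k" using j by (metis of_nat_less_iff of_nat_numeral of_nat_power)
    moreover have "(2 :: int) ^ (k - 1) \<le> 2 ^ k" by (rule power_increasing) simp_all
    ultimately have "0 \<le> (r k + segment_site k r j) $ i" "(r k + segment_site k r j) $ i \<le> 2 ^ k"
      unfolding segment_site_nth by auto
    with rk show ?thesis by simp
  qed
  then have "real_of_int \<bar>segment_site k r j $ i\<bar> \<le> real_of_int (2 ^ k)" for i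
    by (simp only: of_int_le_iff)
  then have "\<bar>rvec (segment_site k r j) $ i\<bar> \<le> 2 ^ k" for i by (simp add: rvec_def)
  then have "(\<Sum>i\<in>UNIV. \<bar>rvec (segment_site k r j) $ i\<bar>) \<le> (\<Sum>i\<in>(UNIV :: 'd set). 2 ^ k)"
    by (intro sum_mono)
  then show ?thesis
    using norm_le_l1_cart[of "rvec (segment_site k r j)"] by simp
qed

text \<open>The heart of the argument, for a single scale \<open>k\<close>: a harmonic \<open>x + X x\<close> varies by at most \<open>N / 4\<close>
  along the segment, where \<open>N = 2 ^ k\<close>, so \<open>X\<close> varies by at least \<open>3 * N / 4 - 1\<close>; but \<open>norm X \<le> N / 4\<close>
  allows at most \<open>N / 2\<close>. The hypothesis \<open>small\<close> is where \<open>A * B > 4\<close> enters.\<close>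

lemma no_sublinear_harmonic:
  fixes X :: "'d site \<Rightarrow> real ^ 'd"
  assumes r: "compatible r" and k: "4 \<le> k"
    and harm: "\<And>x. generator (env r) (\<lambda>z. rvec z + X z) x = 0"
    and small: "16 * real CARD('d) * 4 ^ k \<le> (A * B) ^ k"
    and X: "\<And>x. norm (rvec x) \<le> (CARD('d) + 1) * 2 ^ k \<Longrightarrow> norm (X x) \<le> 2 ^ k / 4"
  shows False
proof -
  define N where "N = (2 :: real) ^ k"
  have N16: "16 \<le> N" using power_increasing[OF k, of "2 :: real"] by (simp add: N_def)
  let ?s = "segment_site k r"
  let ?\<Psi> = "\<lambda>z. rvec z + X z"
  have k2: "2 \<le> k" using k by simp
  have inside: "norm (rvec (?s j)) \<le> CARD('d) * N" if "j < 2 ^ k" for j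
    using norm_segment_site_le[OF r k2 that] by (simp add: N_def)
  have Xs: "norm (X (?s j)) \<le> N / 4" if "j < 2 ^ k" for j
    unfolding N_def by (rule X) (use inside[OF that] N16 in \<open>simp add: N_def algebra_simps\<close>)
  have M: "norm (?\<Psi> (?s j + e) - ?\<Psi> (?s j)) \<le> 2 * N" if j: "j < 2 ^ k" and e: "e \<in> unit_sites" for j e
  proof -
    have e1: "norm (rvec e) = 1" using e by (simp add: unit_sites_def)
    have "norm (rvec (?s j + e)) \<le> CARD('d) * N + 1"
      using norm_triangle_ineq[of "rvec (?s j)" "rvec e"] inside[OF j] e1 by (simp add: rvec_add)
    also have "\<dots> \<le> (CARD('d) + 1) * 2 ^ k" using N16 by (simp add: N_def algebra_simps)
    finally have Xe: "norm (X (?s j + e)) \<le> N / 4" unfolding N_def by (rule X)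
    have eq: "rvec (?s j + e) + X (?s j + e) - (rvec (?s j) + X (?s j)) = rvec e + (X (?s j + e) - X (?s j))"
      by (simp add: rvec_add)
    have "norm (rvec e + (X (?s j + e) - X (?s j))) \<le> norm (rvec e) + (norm (X (?s j + e)) + norm (X (?s j)))"
      by (intro order_trans[OF norm_triangle_ineq] add_mono norm_triangle_ineq4 order_refl)
    also have "\<dots> \<le> 1 + (N / 4 + N / 4)" unfolding e1 by (intro add_mono order_refl Xe Xs[OF j])
    also have "\<dots> \<le> 2 * N" using N16 by simp
    finally show ?thesis unfolding eq .
  qed
  let ?c = "2 * real CARD('d) * (2 * N) / (A * B) ^ k"
  have c0: "0 \<le> ?c" using A1 B1 N16 by simp
  have last: "2 ^ k - 1 < (2 :: nat) ^ k" by simp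
  have "norm (?\<Psi> (?s (2 ^ k - 1)) - ?\<Psi> (?s 0)) \<le> (real (2 ^ k))\<^sup>2 * ?c"
    by (rule norm_endpoints_le[OF c0], rule segment_increments[OF r k2]) (use harm M in auto)
  also have "\<dots> = N * (4 * real CARD('d) * 4 ^ k / (A * B) ^ k)"
    by (simp add: N_def power2_eq_square power_mult_distrib[symmetric])
  also have "\<dots> \<le> N * (1 / 4)"
    using small A1 B1 N16 by (intro mult_left_mono) (simp_all add: divide_simps)
  finally have small_diff: "norm (?\<Psi> (?s (2 ^ k - 1)) - ?\<Psi> (?s 0)) \<le> N / 4" by simp
  have "rvec (?s (2 ^ k - 1)) - rvec (?s 0) = axis i1 (N - 1)"
    by (simp add: segment_site_def rvec_add rvec_axis N_def of_nat_diff flip: rvec_diff)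
  then have "N - 1 = norm (rvec (?s (2 ^ k - 1)) - rvec (?s 0))"
    using N16 by (simp add: norm_axis_real)
  also have "\<dots> = norm ((?\<Psi> (?s (2 ^ k - 1)) - ?\<Psi> (?s 0)) - (X (?s (2 ^ k - 1)) - X (?s 0)))"
    by (simp add: algebra_simps)
  also have "\<dots> \<le> norm (?\<Psi> (?s (2 ^ k - 1)) - ?\<Psi> (?s 0)) + (norm (X (?s (2 ^ k - 1))) + norm (X (?s 0)))"
    by (rule order_trans[OF norm_triangle_ineq4], rule add_mono, rule order_refl, rule norm_triangle_ineq4)
  also have "\<dots> \<le> N / 4 + (N / 4 + N / 4)"
    by (intro add_mono small_diff Xs[OF last] Xs) simp
  finally show False using N16 by linarith
qed

lemma norm_le_of_sublinear:
  fixes X :: "'d site \<Rightarrow> real ^ 'd"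
  assumes lim: "(\<lambda>n::nat. 1 / real n * Max ((\<lambda>x. norm (X x)) ` {x. norm (rvec x) \<le> real n})) \<longlonglongrightarrow> 0"
    and "0 < \<delta>"
  shows "\<forall>\<^sub>F n in sequentially. \<forall>x. norm (rvec x) \<le> real n \<longrightarrow> norm (X x) \<le> \<delta> * real n"
  using order_tendstoD(2)[OF lim \<open>0 < \<delta>\<close>] eventually_gt_at_top[of 0]
proof eventually_elim
  case (elim n)
  show ?case
  proof (intro allI impI)
    fix x :: "'d site" assume x: "norm (rvec x) \<le> real n"
    let ?m = "Max ((\<lambda>x. norm (X x)) ` {x. norm (rvec x) \<le> real n})"
    have "norm (X x) \<le> ?m" using x finite_site_ball by (intro Max_ge) auto
    also have "?m \<le> \<delta> * real n" using elim by (simp add: field_simps)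
    finally show "norm (X x) \<le> \<delta> * real n" .
  qed
qed

text \<open>The ball of radius \<open>(d + 1) * 2 ^ k\<close> contains a segment of scale \<open>k\<close> and its neighbours. Sublinearity on
  these balls with the constant \<open>1 / (4 * (d + 1))\<close> gives the bound \<open>2 ^ k / 4\<close> for all large \<open>k\<close>.\<close>

theorem corrector_not_sublinear:
  assumes AB: "4 < A * B" and X: "is_corrector law X"
  shows "\<not> sublinear_everywhere law X"
proof
  assume sub: "sublinear_everywhere law X"
  interpret prob_space "odometer :: (nat \<Rightarrow> 'd site) measure" by (rule prob_space_odometer)
  have "AE \<omega> in law. \<forall>x. generator \<omega> (\<lambda>z. rvec z + X \<omega> z) x = 0"
    using X by (simp add: is_corrector_def)
  from AE_law_iff_odometer[OF this] AE_law_iff_odometer[OF sub[unfolded sublinear_everywhere_def]] AE_compatible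
  have "AE r in odometer. compatible r \<and> (\<forall>x. generator (env r) (\<lambda>z. rvec z + X (env r) z) x = 0) \<and>
    (\<lambda>n::nat. 1 / real n * Max ((\<lambda>x. norm (X (env r) x)) ` {x. norm (rvec x) \<le> real n})) \<longlonglongrightarrow> 0"
    by eventually_elim simp
  then obtain r where r: "compatible r"
    and harm: "\<And>x. generator (env r) (\<lambda>z. rvec z + X (env r) z) x = 0"
    and lim: "(\<lambda>n::nat. 1 / real n * Max ((\<lambda>x. norm (X (env r) x)) ` {x. norm (rvec x) \<le> real n})) \<longlonglongrightarrow> 0"
    using eventually_happens[of _ "ae_filter odometer"] ae_filter_bot by blast
  define m where "m = CARD('d) + 1"
  have "0 < 1 / (4 * real m)" by (simp add: m_def)
  from norm_le_of_sublinear[OF lim this] obtain n0 where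
    n0: "\<And>n x. n0 \<le> n \<Longrightarrow> norm (rvec x) \<le> real n \<Longrightarrow> norm (X (env r) x) \<le> 1 / (4 * real m) * real n"
    unfolding eventually_sequentially by blast
  have "(\<lambda>k. (4 / (A * B)) ^ k) \<longlonglongrightarrow> 0" using AB by (intro LIMSEQ_power_zero) simp
  moreover have "0 < 1 / (16 * real CARD('d))" by simp
  ultimately have "\<forall>\<^sub>F k in sequentially. (4 / (A * B)) ^ k < 1 / (16 * real CARD('d))"
    by (rule order_tendstoD(2))
  then obtain k0 where k0: "\<And>k. k0 \<le> k \<Longrightarrow> (4 / (A * B)) ^ k < 1 / (16 * real CARD('d))"
    unfolding eventually_sequentially by blast
  define k where "k = max 4 (max n0 k0)"
  show False
  proof (rule no_sublinear_harmonic[OF r _ harm])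
    show "4 \<le> k" by (simp add: k_def)
    have "(4 / (A * B)) ^ k < 1 / (16 * real CARD('d))" by (rule k0) (simp add: k_def)
    then have "4 ^ k / (A * B) ^ k < 1 / (16 * real CARD('d))" by (simp only: power_divide)
    moreover have "0 < (A * B) ^ k" using AB by simp
    moreover have "16 * D * a \<le> c" if "a / c < 1 / (16 * D)" "0 < c" "0 < D" for a c D :: real
      using that by (simp add: field_simps)
    ultimately show "16 * real CARD('d) * 4 ^ k \<le> (A * B) ^ k" by simp
    fix x :: "'d site" assume x: "norm (rvec x) \<le> (CARD('d) + 1) * 2 ^ k"
    have "n0 \<le> k" by (simp add: k_def)
    also have "k \<le> 2 ^ k" by (simp add: less_imp_le)
    also have "\<dots> \<le> m * 2 ^ k" by (simp add: m_def)
    finally have "norm (X (env r) x) \<le> 1 / (4 * real m) * real (m * 2 ^ k)"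
      using x by (intro n0) (simp_all add: m_def)
    also have "\<dots> = 2 ^ k / 4"
    proof -
      have "real m \<noteq> 0" by (simp add: m_def)
      then show ?thesis by simp
    qed
    finally show "norm (X (env r) x) \<le> 2 ^ k / 4" .
  qed
qed

end

section \<open>Choice of the conductances\<close>

text \<open>With \<open>s = d - 1\<close>, the extreme choice \<open>A = 2 powr (s / p)\<close>, \<open>B = 2 powr (s / q)\<close> has
  \<open>A * B = 2 powr (s / p + s / q) > 4\<close> by hypothesis. Scaling both exponents by \<open>t < 1\<close> makes the moment
  bounds strict and, for \<open>t\<close> close to \<open>1\<close>, keeps the product above \<open>4\<close>.\<close>

lemma exponents_exist:
  fixes p q s :: real
  assumes "1 \<le> p" "1 \<le> q" "0 < s" and big: "1 / p + 1 / q > 2 / s"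
  obtains A B :: real where "1 \<le> A" "1 \<le> B" "A powr p < 2 powr s" "B powr q < 2 powr s" "4 < A * B"
proof -
  define \<sigma> where "\<sigma> = s / p + s / q"
  have \<sigma>: "2 < \<sigma>"
  proof -
    have "s * (2 / s) < s * (1 / p + 1 / q)" using big \<open>0 < s\<close> by (rule mult_strict_left_mono)
    then show ?thesis using \<open>0 < s\<close> by (simp add: \<sigma>_def distrib_left)
  qed
  define t where "t = (1 + 2 / \<sigma>) / 2"
  have t: "0 < t" "t < 1" "2 < t * \<sigma>" using \<sigma> by (simp_all add: t_def field_simps)
  have pow_less: "(2 powr (t * s / p)) powr p < 2 powr s" if "1 \<le> p" for p :: real
    using that t \<open>0 < s\<close> by (simp add: powr_powr)
  show ?thesis
  proof (rule that)
    show "1 \<le> 2 powr (t * s / p)" "1 \<le> 2 powr (t * s / q)"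
      using assms t by (simp_all add: ge_one_powr_ge_zero)
    show "(2 powr (t * s / p)) powr p < 2 powr s" "(2 powr (t * s / q)) powr q < 2 powr s"
      by (rule pow_less[OF assms(1)], rule pow_less[OF assms(2)])
    have "4 = 2 powr (2 :: real)" by simp
    also have "\<dots> < 2 powr (t * \<sigma>)" using t by (intro powr_less_mono) simp_all
    also have "\<dots> = 2 powr (t * s / p) * 2 powr (t * s / q)"
      by (simp add: \<sigma>_def powr_add[symmetric] distrib_left)
    finally show "4 < 2 powr (t * s / p) * 2 powr (t * s / q)" .
  qed
qed

theorem theorem2p6:
  fixes p q :: real
  assumes "3 \<le> CARD('d::finite)"
    and "1 \<le> p" and "1 \<le> q"
    and "1 / p + 1 / q > 2 / (real CARD('d) - 1)"
  shows "\<exists>P :: 'd conf measure.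
    conductance_law P \<and> stationary P \<and> jointly_ergodic P \<and> moment_conditions P p q \<and>
    corrector_well_defined P \<and>
    (\<forall>X. is_corrector P X \<longrightarrow> \<not> sublinear_everywhere P X)"
proof -
  have "\<exists>i1 i2 :: 'd. i1 \<noteq> i2"
  proof (rule ccontr)
    assume "\<nexists>i1 i2 :: 'd. i1 \<noteq> i2"
    then have "(UNIV :: 'd set) \<subseteq> {undefined}" by auto
    from card_mono[OF _ this] show False using assms(1) by simp
  qed
  then obtain i1 i2 :: 'd where i12: "i1 \<noteq> i2" by blast
  have s: "2 powr (real CARD('d) - 1) = 2 ^ (CARD('d) - 1)"
  proof -
    have "real CARD('d) - 1 = real (CARD('d) - 1)" using assms(1) by simp
    then show ?thesis by (simp only: powr_realpow)
  qed
  have "0 < real CARD('d) - 1" using assms(1) by simp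
  from exponents_exist[OF assms(2,3) this assms(4)] obtain A B :: real
    where A: "1 \<le> A" "A powr p < 2 ^ (CARD('d) - 1)" and B: "1 \<le> B" "B powr q < 2 ^ (CARD('d) - 1)"
      and AB: "4 < A * B"
    unfolding s by metis
  interpret line_model i1 i2 A B by unfold_locales (fact i12 A B)+
  \<comment> \<open>Exponent \<open>1\<close> gives the integrability of \<open>C\<close> and \<open>1 / C\<close>
    behind the corrector.\<close>
  have A1: "A powr 1 < 2 ^ (CARD('d) - 1)" using powr_mono[OF assms(2) A(1)] A(2) by linarith
  have B1: "B powr 1 < 2 ^ (CARD('d) - 1)" using powr_mono[OF assms(3) B(1)] B(2) by linarith
  have abs_int: "integrable law f" if "in_Lp law 1 f" for f
  proof -
    have "(\<lambda>\<omega>. \<bar>f \<omega>\<bar> powr 1) = (\<lambda>\<omega>. \<bar>f \<omega>\<bar>)" by (simp add: fun_eq_iff)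
    moreover have "f \<in> borel_measurable law" using that by (simp add: in_Lp_def)
    ultimately show ?thesis using that integrable_abs_iff[of f law] by (simp add: in_Lp_def)
  qed
  interpret S: stationary_conductances law
    using conductance_law_law stationary_law AE_law_pos abs_int[OF in_Lp_conductance[OF _ A1]]
    by unfold_locales simp_all
  have "moment_conditions law p q"
    unfolding moment_conditions_def
    using in_Lp_conductance[OF _ A(2)] in_Lp_resistance[OF _ B(2)] AE_law_pos assms(2,3)
    by (simp add: unit_sites_def)
  moreover have "corrector_well_defined law"
    by (rule S.corrector_well_definedI, rule abs_int, rule in_Lp_resistance[OF _ B1]) simp_all
  ultimately show ?thesis
    using conductance_law_law stationary_law jointly_ergodic_law corrector_not_sublinear[OF AB] by blast
qed

end
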